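(* Suppose $G$ is a group equipped with a group topology $\sigma$, acting as automorphisms on a ring $R$. Put $R_1=R\times\mathbb{Z}$, and define $+$ and $\cdot$ on $R_1$ by $(a,k)+(b,l)=(a+b,k+l)$ and $(a,k)\cdot(b,l)=(ab+l\times a+k\times b,\ k\cdot l)$, where $l\times a$ denotes the integer multiple of $a$. Then $G$ acts on $R_1$ as automorphisms by $g(a,k):=(g(a),k)$; consider the induced (entrywise) action of $G$ on the group $GL_3(R_1)$. Identify $R$ with the subset $$\left\{\begin{pmatrix}1&0&x\\0&1&0\\0&0&1\end{pmatrix}:x\in R\right\}$$ of $GL_3(R_1)$ (where $x\in R$ is viewed as the element $(x,0)\in R_1$). Denote by $T^r(R,G)$ the topology induced on $R$ by $T'(GL_3(R_1),G)$. Then $T^r(R,G)$ is the finest ring topology on $R$ such that the action of $G$ on $R$ is continuous.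
   Context: Rings are not assumed to have a unit. A group topology on a group is a topology for which multiplication and inversion are continuous (not necessarily Hausdorff); a semigroup topology on a group is a topology for which multiplication is continuous; a ring topology on a ring is a topology for which addition, additive inversion and multiplication are continuous. "The action of $G$ on $R$ is continuous" means that the map $G\times R\to R$ is (jointly) continuous. $GL_3(R_1)$ is the group of invertible $3\times 3$ matrices over the unital ring $R_1$ (with unit $(0,1)$). Definition of $T'(H,G)$ for a group $H$ on which the topological group $(G,\sigma)$ acts as automorphisms. For a group $K$ with neutral element $e$ and $S\subseteq K$ write $S^{\#}=S\cup\{e\}$. For a $\mathbb{Q}$-tuple $(S_q)_{q\in\mathbb{Q}}$ of subsets of $K$ put $$U'((S_q)_{q\in\mathbb{Q}})=\bigcup_{n<\omega}\ \bigcup_{q_1<\dots<q_n\in\mathbb{Q}}S_{q_1}^{\#}\cdots S_{q_n}^{\#}.$$ For a family $F$ of subsets of $K$, let $F^K$ be the collection of all sets $\bigcup_{g\in K}gS_gg^{-1}$ for $K$-tuples $(S_g)_{g\in K}$ of members of $F$. For a downward directed family $F$ of nonempty subsets of $K$, the sets $U'((S_q)_{q\in\mathbb{Q}})$, with $(S_q)_{q\in\mathbb{Q}}$ ranging over all $\mathbb{Q}$-tuples of members of $F^K$, form a basis of open neighbourhoods of $e$ in a semigroup topology $\mathcal{T}'_F$ on $K$, which is the finest semigroup topology on $K$ under which $F$ converges to $e$ (i.e. every neighbourhood of $e$ contains a member of $F$). For a topology $\rho$ on $K$, $\rho^{\#}$ denotes $\mathcal{T}'_F$, where $F$ is the family of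 $\rho$-open neighbourhoods of $e$. Now let $H\rtimes G$ be the semidirect product, i.e. $H\times G$ with $(h,g)(h',g')=(h\cdot g(h'),gg')$, let $D$ be the discrete topology on $H$, and put $T'=(D\times\sigma)^{\#}$ on $H\rtimes G$. Then $T'(H,G)$ is the topology induced by $T'$ on the subgroup $H\times\{e\}$, identified with $H$. *)

theory Defs
  imports "HOL-Analysis.Analysis" "HOL-Algebra.Group_Action"
begin

section \<open>Group topologies, ring topologies, continuous actions\<close>

text \<open>Groups are carrier-based (HOL-Algebra); rings, which need not have a unit, are types of class
  \<open>ring\<close>. No topology is assumed to be Hausdorff.\<close>

definition group_topology :: "('g, 'm) monoid_scheme \<Rightarrow> 'g topology \<Rightarrow> bool" where
  "group_topology G \<sigma> \<longleftrightarrow>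
     topspace \<sigma> = carrier G \<and>
     continuous_map (prod_topology \<sigma> \<sigma>) \<sigma> (\<lambda>(x, y). x \<otimes>\<^bsub>G\<^esub> y) \<and>
     continuous_map \<sigma> \<sigma> (\<lambda>x. inv\<^bsub>G\<^esub> x)"

definition ring_topology :: "'r::ring topology \<Rightarrow> bool" where
  "ring_topology \<tau> \<longleftrightarrow>
     topspace \<tau> = UNIV \<and>
     continuous_map (prod_topology \<tau> \<tau>) \<tau> (\<lambda>(x, y). x + y) \<and>
     continuous_map \<tau> \<tau> (\<lambda>x. - x) \<and>
     continuous_map (prod_topology \<tau> \<tau>) \<tau> (\<lambda>(x, y). x * y)"

definition ring_automorphism_action :: "('g, 'm) monoid_scheme \<Rightarrow> ('g \<Rightarrow> 'r::ring \<Rightarrow> 'r) \<Rightarrow> bool" where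
  "ring_automorphism_action G \<alpha> \<longleftrightarrow>
     group_action G UNIV \<alpha> \<and>
     (\<forall>g\<in>carrier G. \<forall>a b. \<alpha> g (a + b) = \<alpha> g a + \<alpha> g b \<and> \<alpha> g (a * b) = \<alpha> g a * \<alpha> g b)"

definition continuous_action :: "'g topology \<Rightarrow> 'r topology \<Rightarrow> ('g \<Rightarrow> 'r \<Rightarrow> 'r) \<Rightarrow> bool" where
  "continuous_action \<sigma> \<tau> \<alpha> \<longleftrightarrow> continuous_map (prod_topology \<sigma> \<tau>) \<tau> (\<lambda>(g, x). \<alpha> g x)"


section \<open>The topology \<open>T'\<^sub>F\<close> on a group\<close>

text \<open>\<open>U' K S\<close> is the union, over all finite strictly increasing sequences of rationals
  \<open>q\<^sub>1 < \<dots> < q\<^sub>n\<close> (including the empty one), of the products of the sets \<open>S q\<^sub>i \<union> {e}\<close> in this order.\<close>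

definition U' :: "('k, 'm) monoid_scheme \<Rightarrow> (rat \<Rightarrow> 'k set) \<Rightarrow> 'k set" where
  "U' K S = (\<Union>qs\<in>{qs. sorted_wrt (<) qs}.
     foldr (\<lambda>q A. (S q \<union> {\<one>\<^bsub>K\<^esub>}) <#>\<^bsub>K\<^esub> A) qs {\<one>\<^bsub>K\<^esub>})"

definition conj_family :: "('k, 'm) monoid_scheme \<Rightarrow> 'k set set \<Rightarrow> 'k set set" where
  "conj_family K F =
     {\<Union>g\<in>carrier K. (g <#\<^bsub>K\<^esub> S g) #>\<^bsub>K\<^esub> inv\<^bsub>K\<^esub> g | S. \<forall>g\<in>carrier K. S g \<in> F}"

text \<open>For a downward directed family \<open>F\<close> of nonempty subsets of a group \<open>K\<close>, the sets \<open>U' K S\<close> are a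
  basis of open neighbourhoods of the neutral element in a semigroup topology. As left translations
  are homeomorphisms of such a topology, the left translates of these sets are a basis of the
  topology, so in particular they generate it.\<close>

definition T'_fam :: "('k, 'm) monoid_scheme \<Rightarrow> 'k set set \<Rightarrow> 'k topology" where
  "T'_fam K F = topology_generated_by
     {x <#\<^bsub>K\<^esub> U' K S | x S. x \<in> carrier K \<and> (\<forall>q. S q \<in> conj_family K F)}"

definition sharp_topology :: "('k, 'm) monoid_scheme \<Rightarrow> 'k topology \<Rightarrow> 'k topology" where
  "sharp_topology K \<rho> = T'_fam K {V. openin \<rho> V \<and> \<one>\<^bsub>K\<^esub> \<in> V}"


section \<open>Semidirect products and \<open>T'(H, G)\<close>\<close>

definition semidirect ::
  "('h, 'm) monoid_scheme \<Rightarrow> ('g, 'n) monoid_scheme \<Rightarrow> ('g \<Rightarrow> 'h \<Rightarrow> 'h) \<Rightarrow> ('h \<times> 'g) monoid" where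
  "semidirect H G \<alpha> =
     \<lparr>carrier = carrier H \<times> carrier G,
      mult = (\<lambda>(h, g) (h', g'). (h \<otimes>\<^bsub>H\<^esub> \<alpha> g h', g \<otimes>\<^bsub>G\<^esub> g')),
      one = (\<one>\<^bsub>H\<^esub>, \<one>\<^bsub>G\<^esub>)\<rparr>"

lemma group_semidirect:
  assumes "group H" and "group G"
    and hom: "\<And>g. g \<in> carrier G \<Longrightarrow> \<alpha> g \<in> hom H H"
    and one: "\<And>h. h \<in> carrier H \<Longrightarrow> \<alpha> \<one>\<^bsub>G\<^esub> h = h"
    and mult: "\<And>g g' h. g \<in> carrier G \<Longrightarrow> g' \<in> carrier G \<Longrightarrow> h \<in> carrier H \<Longrightarrow>
      \<alpha> (g \<otimes>\<^bsub>G\<^esub> g') h = \<alpha> g (\<alpha> g' h)"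
  shows "group (semidirect H G \<alpha>)"
proof -
  interpret H: group H by fact
  interpret G: group G by fact
  have closed [simp]: "\<alpha> g h \<in> carrier H" if "g \<in> carrier G" "h \<in> carrier H" for g h
    using hom[OF that(1)] that(2) by (auto simp: hom_def)
  have distr: "\<alpha> g (h \<otimes>\<^bsub>H\<^esub> h') = \<alpha> g h \<otimes>\<^bsub>H\<^esub> \<alpha> g h'"
    if "g \<in> carrier G" "h \<in> carrier H" "h' \<in> carrier H" for g h h'
    using hom[OF that(1)] that(2,3) by (auto simp: hom_def)
  have unit: "\<alpha> g \<one>\<^bsub>H\<^esub> = \<one>\<^bsub>H\<^esub>" if "g \<in> carrier G" for g
    using hom_one[OF hom[OF that]] assms(1) by blast
  show ?thesis
  proof (rule groupI)
    fix p assume "p \<in> carrier (semidirect H G \<alpha>)"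
    then obtain h g where p: "p = (h, g)" "h \<in> carrier H" "g \<in> carrier G"
      by (auto simp: semidirect_def)
    let ?q = "(\<alpha> (inv\<^bsub>G\<^esub> g) (inv\<^bsub>H\<^esub> h), inv\<^bsub>G\<^esub> g)"
    have "?q \<otimes>\<^bsub>semidirect H G \<alpha>\<^esub> p = \<one>\<^bsub>semidirect H G \<alpha>\<^esub>"
      using p by (simp add: semidirect_def distr[symmetric] unit)
    then show "\<exists>q\<in>carrier (semidirect H G \<alpha>). q \<otimes>\<^bsub>semidirect H G \<alpha>\<^esub> p = \<one>\<^bsub>semidirect H G \<alpha>\<^esub>"
      using p by (intro bexI[of _ ?q]) (auto simp: semidirect_def)
  qed (auto simp: semidirect_def distr mult one H.m_assoc G.m_assoc)
qed

text \<open>The topology induced on \<open>H \<times> {e}\<close>, transported to \<open>H\<close> along \<open>h \<mapsto> (h, e)\<close>.\<close>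

definition T'_topology ::
  "('h, 'm) monoid_scheme \<Rightarrow> ('g, 'n) monoid_scheme \<Rightarrow> 'g topology \<Rightarrow> ('g \<Rightarrow> 'h \<Rightarrow> 'h) \<Rightarrow> 'h topology" where
  "T'_topology H G \<sigma> \<alpha> =
     pullback_topology (carrier H) (\<lambda>h. (h, \<one>\<^bsub>G\<^esub>))
       (sharp_topology (semidirect H G \<alpha>) (prod_topology (discrete_topology (carrier H)) \<sigma>))"


section \<open>The unital ring \<open>R\<^sub>1 = R \<times> \<int>\<close>\<close>

definition int_multiple :: "int \<Rightarrow> 'r::ab_group_add \<Rightarrow> 'r" where
  "int_multiple l a = (if 0 \<le> l then \<Sum>i<nat l. a else - (\<Sum>i<nat (- l). a))"

lemma int_multiple_0 [simp]: "int_multiple 0 a = 0"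
  and int_multiple_1 [simp]: "int_multiple 1 a = a"
  by (simp_all add: int_multiple_def lessThan_Suc)

lemma int_multiple_add1: "int_multiple (l + 1) a = int_multiple l a + a"
proof -
  consider "0 \<le> l" | "l < 0" by linarith
  then show ?thesis
  proof cases
    case 1
    then have "nat (l + 1) = Suc (nat l)" by simp
    then show ?thesis using 1 by (simp add: int_multiple_def)
  next
    case 2
    then have "nat (- l) = Suc (nat (- (l + 1)))" by simp
    then show ?thesis using 2 by (auto simp: int_multiple_def)
  qed
qed

lemma int_multiple_diff1: "int_multiple (l - 1) a = int_multiple l a - a"
  using int_multiple_add1[of "l - 1" a] by (simp add: algebra_simps)

lemma int_multiple_add_left: "int_multiple (k + l) a = int_multiple k a + int_multiple l a"
proof (induction l rule: int_induct[where k = 0])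
  case (step1 i)
  then show ?case
    by (metis add.assoc int_multiple_add1)
next
  case (step2 i)
  then show ?case
    by (metis add_diff_eq int_multiple_diff1)
qed simp

lemma int_multiple_minus_left: "int_multiple (- l) a = - int_multiple l a"
  using int_multiple_add_left[of "- l" l a] by (simp add: eq_neg_iff_add_eq_0)

lemma additive_int_multiple:
  assumes "\<And>x y. f (x + y) = f x + f y"
  shows "f (int_multiple l a) = int_multiple l (f a)"
proof -
  have "f 0 + f 0 = f 0" using assms[of 0 0] by simp
  then have [simp]: "f 0 = 0" by simp
  have d: "f (x - y) = f x - f y" for x y
    using assms[of "x - y" y] by simp
  show ?thesis
    by (induction l rule: int_induct[where k = 0])
      (simp_all add: int_multiple_add1 int_multiple_diff1 assms d)
qed

lemma int_multiple_add_right: "int_multiple l (a + b) = int_multiple l a + int_multiple l b"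
  by (induction l rule: int_induct[where k = 0])
    (simp_all add: int_multiple_add1 int_multiple_diff1 algebra_simps)

lemma int_multiple_mult: "int_multiple (k * l) a = int_multiple k (int_multiple l a)"
proof (induction k rule: int_induct[where k = 0])
  case (step1 i)
  then show ?case by (simp add: int_multiple_add1 int_multiple_add_left distrib_right)
next
  case (step2 i)
  have "int_multiple ((i - 1) * l) a = int_multiple (i * l) a + int_multiple (- l) a"
    by (simp add: int_multiple_add_left[symmetric] algebra_simps)
  then show ?case using step2 by (simp add: int_multiple_diff1 int_multiple_minus_left)
qed simp

lemma int_multiple_times_left: "int_multiple l a * b = int_multiple l (a * b)"
  for a :: "'r::ring"
  by (rule additive_int_multiple[where f = "\<lambda>x. x * b"]) (simp add: distrib_right)

lemma int_multiple_times_right: "b * int_multiple l a = int_multiple l (b * a)"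
  for a :: "'r::ring"
  by (rule additive_int_multiple[where f = "\<lambda>x. b * x"]) (simp add: distrib_left)

datatype 'r unitization = Unitization (ring_part: 'r) (int_part: int)

instantiation unitization :: (ring) ring_1
begin

definition "0 = Unitization 0 0"
definition "1 = Unitization 0 1"
definition "x + y = Unitization (ring_part x + ring_part y) (int_part x + int_part y)"
definition "- x = Unitization (- ring_part x) (- int_part x)"
definition "x - y = Unitization (ring_part x - ring_part y) (int_part x - int_part y)"
definition "x * y = Unitization
  (ring_part x * ring_part y + int_multiple (int_part y) (ring_part x)
     + int_multiple (int_part x) (ring_part y))
  (int_part x * int_part y)"

instance
proof
  fix x y z :: "'a unitization"
  note defs = zero_unitization_def one_unitization_def plus_unitization_def
    uminus_unitization_def minus_unitization_def times_unitization_def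
  show "x + y + z = x + (y + z)" by (simp add: defs)
  show "x + y = y + x" by (simp add: defs)
  show "0 + x = x" by (simp add: defs)
  show "- x + x = 0" by (simp add: defs)
  show "x - y = x + - y" by (simp add: defs)
  show "1 * x = x" by (simp add: defs additive_int_multiple[where f = "\<lambda>_. 0", symmetric])
  show "x * 1 = x" by (simp add: defs additive_int_multiple[where f = "\<lambda>_. 0", symmetric])
  show "(0 :: 'a unitization) \<noteq> 1" by (simp add: defs)
  show "(x + y) * z = x * z + y * z"
    by (simp add: defs algebra_simps int_multiple_add_left int_multiple_add_right)
  show "x * (y + z) = x * y + x * z"
    by (simp add: defs algebra_simps int_multiple_add_left int_multiple_add_right)
  show "x * y * z = x * (y * z)"
    by (simp add: defs algebra_simps int_multiple_add_right int_multiple_times_left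
        int_multiple_times_right int_multiple_mult[symmetric])
qed

end

definition unitization_action :: "('g \<Rightarrow> 'r \<Rightarrow> 'r) \<Rightarrow> 'g \<Rightarrow> 'r unitization \<Rightarrow> 'r unitization" where
  "unitization_action \<alpha> g x = Unitization (\<alpha> g (ring_part x)) (int_part x)"

lemma group_action_UNIV_iff:
  assumes "group G"
  shows "group_action G UNIV \<alpha> \<longleftrightarrow>
    (\<forall>x. \<alpha> \<one>\<^bsub>G\<^esub> x = x) \<and>
    (\<forall>g\<in>carrier G. \<forall>h\<in>carrier G. \<forall>x. \<alpha> (g \<otimes>\<^bsub>G\<^esub> h) x = \<alpha> g (\<alpha> h x))" (is "?L \<longleftrightarrow> ?R")
proof
  assume ?L
  then interpret group_action G UNIV \<alpha> .
  show ?R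
    using id_eq_one composition_rule by (metis UNIV_I restrict_UNIV)
next
  assume R: ?R
  interpret group G by fact
  have "bij (\<alpha> g)" if "g \<in> carrier G" for g
  proof (rule o_bij)
    show "\<alpha> (inv\<^bsub>G\<^esub> g) \<circ> \<alpha> g = id" "\<alpha> g \<circ> \<alpha> (inv\<^bsub>G\<^esub> g) = id"
      using R that by (auto simp: fun_eq_iff) (metis inv_closed l_inv r_inv)+
  qed
  then have B: "\<alpha> g \<in> Bij UNIV" if "g \<in> carrier G" for g
    using that by (simp add: Bij_def)
  have "\<alpha> \<in> hom G (BijGroup UNIV)"
    using R B by (auto simp: hom_def BijGroup_def compose_def fun_eq_iff)
  then show ?L
    unfolding group_action_def group_hom_def group_hom_axioms_def
    using assms group_BijGroup by blast
qed

lemma unitization_action_automorphism: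
  assumes "group G" and "ring_automorphism_action G \<alpha>"
  shows "ring_automorphism_action G (unitization_action \<alpha>)"
proof -
  have im: "\<alpha> g (int_multiple l a) = int_multiple l (\<alpha> g a)" if "g \<in> carrier G" for g l a
    using assms(2) that by (intro additive_int_multiple) (auto simp: ring_automorphism_action_def)
  show ?thesis
    using assms(2) im
    by (auto simp: ring_automorphism_action_def group_action_UNIV_iff[OF assms(1)]
        unitization_action_def plus_unitization_def times_unitization_def)
qed


section \<open>\<open>GL\<^sub>3(R\<^sub>1)\<close> and the topology \<open>T\<^sup>r(R, G)\<close>\<close>

definition GL3 :: "('a::ring_1 ^ 3 ^ 3) monoid" where
  "GL3 = \<lparr>carrier = {A. invertible A}, mult = (**), one = mat 1\<rparr>"

lemma group_GL3: "group (GL3 :: ('a::ring_1 ^ 3 ^ 3) monoid)"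
proof (rule groupI)
  fix A B :: "'a ^ 3 ^ 3"
  show "A \<otimes>\<^bsub>GL3\<^esub> B \<in> carrier GL3" if "A \<in> carrier GL3" "B \<in> carrier GL3"
  proof -
    from that obtain A' B' where
      "A ** A' = mat 1" "A' ** A = mat 1" "B ** B' = mat 1" "B' ** B = mat 1"
      by (auto simp: GL3_def invertible_def)
    then have "(A ** B) ** (B' ** A') = mat 1" "(B' ** A') ** (A ** B) = mat 1"
      by (metis matrix_mul_assoc matrix_mul_rid)+
    then show ?thesis by (auto simp: GL3_def invertible_def)
  qed
  show "\<exists>B\<in>carrier GL3. B \<otimes>\<^bsub>GL3\<^esub> A = \<one>\<^bsub>GL3\<^esub>" if "A \<in> carrier GL3"
    using that by (auto simp: GL3_def invertible_def)
  show "\<one>\<^bsub>GL3\<^esub> \<in> carrier (GL3 :: ('a ^ 3 ^ 3) monoid)"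
    by (auto simp: GL3_def invertible_def intro: exI[of _ "mat 1"])
qed (simp_all add: GL3_def matrix_mul_assoc)

lemma group_semidirect_GL3:
  fixes \<alpha> :: "'g \<Rightarrow> 'r::ring \<Rightarrow> 'r"
  assumes "group G" and "ring_automorphism_action G \<alpha>"
  shows "group (semidirect GL3 G (\<lambda>g. map_matrix (unitization_action \<alpha> g)))"
proof (rule group_semidirect[OF group_GL3 assms(1)])
  let ?\<beta> = "unitization_action \<alpha>"
  have aut: "ring_automorphism_action G ?\<beta>"
    using assms by (rule unitization_action_automorphism)
  then have act: "?\<beta> \<one>\<^bsub>G\<^esub> x = x"
    "g \<in> carrier G \<Longrightarrow> h \<in> carrier G \<Longrightarrow> ?\<beta> (g \<otimes>\<^bsub>G\<^esub> h) x = ?\<beta> g (?\<beta> h x)" for g h x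
    by (auto simp: ring_automorphism_action_def group_action_UNIV_iff[OF assms(1)])
  show "map_matrix (?\<beta> \<one>\<^bsub>G\<^esub>) A = A" for A :: "'r unitization ^ 3 ^ 3"
    by (simp add: vec_eq_iff act)
  show "map_matrix (?\<beta> (g \<otimes>\<^bsub>G\<^esub> h)) A = map_matrix (?\<beta> g) (map_matrix (?\<beta> h) A)"
    if "g \<in> carrier G" "h \<in> carrier G" for g h and A :: "'r unitization ^ 3 ^ 3"
    by (simp add: vec_eq_iff act that)
  fix g assume g: "g \<in> carrier G"
  have add: "?\<beta> g (x + y) = ?\<beta> g x + ?\<beta> g y" and times: "?\<beta> g (x * y) = ?\<beta> g x * ?\<beta> g y" for x y
    using aut g by (auto simp: ring_automorphism_action_def)
  have zero: "\<alpha> g 0 = 0"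
    using assms(2) g by (metis add_cancel_right_right ring_automorphism_action_def)
  have mult: "map_matrix (?\<beta> g) (A ** B) = map_matrix (?\<beta> g) A ** map_matrix (?\<beta> g) B"
    for A B :: "'r unitization ^ 3 ^ 3"
    by (simp add: vec_eq_iff matrix_matrix_mult_def sum_3 add times)
  have one: "map_matrix (?\<beta> g) (mat 1) = mat 1"
    by (simp add: vec_eq_iff mat_def unitization_action_def zero_unitization_def
        one_unitization_def zero)
  have "invertible (map_matrix (?\<beta> g) A)" if "invertible A" for A :: "'r unitization ^ 3 ^ 3"
    using that unfolding invertible_def by (metis mult one)
  then show "map_matrix (?\<beta> g) \<in> hom GL3 GL3"
    by (auto simp: hom_def GL3_def mult)
qed

definition ring_embedding :: "'r::ring \<Rightarrow> 'r unitization ^ 3 ^ 3" where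
  "ring_embedding x = vector
     [vector [1, 0, Unitization x 0],
      vector [0, 1, 0],
      vector [0, 0, 1]]"

definition Tr_topology ::
  "('g, 'm) monoid_scheme \<Rightarrow> 'g topology \<Rightarrow> ('g \<Rightarrow> 'r::ring \<Rightarrow> 'r) \<Rightarrow> 'r topology" where
  "Tr_topology G \<sigma> \<alpha> =
     pullback_topology UNIV ring_embedding
       (T'_topology GL3 G \<sigma> (\<lambda>g. map_matrix (unitization_action \<alpha> g)))"

end

theory Submission
  imports Defs
begin

text \<open>
  Let \<open>K\<close> be the semidirect product of \<open>GL\<^sub>3(R\<^sub>1)\<close> and \<open>G\<close>, and \<open>T'\<close> its topology. Two facts about \<open>T'\<close>
  are the source of everything. It is a semigroup topology for which the map \<open>g \<mapsto> (1, g)\<close> from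
  \<open>(G, \<sigma>)\<close> is continuous (\<open>semigroup_topology_T'_fam\<close>, \<open>continuous_G_in_T'\<close>), and it is the finest
  such topology (\<open>T'_fam_finest\<close>, \<open>T'_finest\<close>).

  Continuity of multiplication in \<open>K\<close> already gives all the continuity needed on \<open>R\<close>, because
  each operation on \<open>R\<close> is a product in \<open>K\<close> of fixed elements and of elements that depend continuously
  on the arguments.
  Write \<open>E\<^sub>i\<^sub>j(x)\<close> for the elementary matrix with entry \<open>x\<close> at \<open>(i, j)\<close>, so that \<open>x\<close> is identified
  with \<open>E\<^sub>1\<^sub>3(x)\<close>. Addition is matrix multiplication; negation is conjugation by the diagonal matrix
  \<open>(-1, 1, 1)\<close>; conjugation by permutation matrices turns \<open>E\<^sub>1\<^sub>3\<close> into \<open>E\<^sub>1\<^sub>2\<close> and \<open>E\<^sub>2\<^sub>3\<close>, and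
  \<open>E\<^sub>1\<^sub>3(x y) = E\<^sub>1\<^sub>2(x) E\<^sub>2\<^sub>3(y) E\<^sub>1\<^sub>2(-x) E\<^sub>2\<^sub>3(-y)\<close> is a commutator. The action of \<open>g\<close> is conjugation by
  \<open>(1, g)\<close> in \<open>K\<close>, where inverting \<open>g\<close> is harmless since \<open>\<sigma>\<close> is a group topology.

  Conversely, a ring topology \<open>\<tau>\<close> with continuous action extends to \<open>K\<close>: give \<open>R\<^sub>1\<close> the product of
  \<open>\<tau>\<close> with the discrete topology on the integers, \<open>GL\<^sub>3(R\<^sub>1)\<close> the entrywise topology, and \<open>K\<close> the
  product with \<open>\<sigma>\<close>. Multiplication in \<open>K\<close> is polynomial in the matrix entries and in the action, hence
  continuous; inversion of matrices may fail to be, which is why semigroup topologies are the right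
  notion here. So \<open>T'\<close> is finer than this topology, and reading off the upper right entry shows that
  \<open>T\<^sup>r(R, G)\<close> is finer than \<open>\<tau>\<close>.
\<close>

section \<open>Semigroup topologies\<close>

definition semigroup_topology :: "('k, 'm) monoid_scheme \<Rightarrow> 'k topology \<Rightarrow> bool" where
  "semigroup_topology K \<tau> \<longleftrightarrow>
     topspace \<tau> = carrier K \<and>
     continuous_map (prod_topology \<tau> \<tau>) \<tau> (\<lambda>(x, y). x \<otimes>\<^bsub>K\<^esub> y)"

abbreviation ordered_product :: "('k, 'm) monoid_scheme \<Rightarrow> ('i \<Rightarrow> 'k set) \<Rightarrow> 'i list \<Rightarrow> 'k set" where
  "ordered_product K S qs \<equiv>
     foldr (\<lambda>q A. (S q \<union> {\<one>\<^bsub>K\<^esub>}) <#>\<^bsub>K\<^esub> A) qs {\<one>\<^bsub>K\<^esub>}"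

lemma semigroup_topology_times:
  assumes "semigroup_topology K \<tau>" "continuous_map X \<tau> f" "continuous_map X \<tau> g"
  shows "continuous_map X \<tau> (\<lambda>x. f x \<otimes>\<^bsub>K\<^esub> g x)"
  using continuous_map_compose[OF continuous_map_pairedI[OF assms(2,3)], of \<tau> "\<lambda>(x, y). x \<otimes>\<^bsub>K\<^esub> y"] assms(1)
  by (simp add: semigroup_topology_def o_def)

lemma set_multI: "x \<in> A \<Longrightarrow> y \<in> B \<Longrightarrow> x \<otimes>\<^bsub>K\<^esub> y \<in> A <#>\<^bsub>K\<^esub> B"
  unfolding set_mult_def by blast

text \<open>Iterating this gives a decreasing chain of neighbourhoods \<open>N\<^sub>n\<close> in which the triple product of
  \<open>N\<^sub>n\<^sub>+\<^sub>1\<close> lies in \<open>N\<^sub>n\<close>, inside which products of any length can be controlled.\<close>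

lemma semigroup_topology_cube_root:
  assumes \<tau>: "semigroup_topology K \<tau>" and "group K"
    and N: "openin \<tau> N" "\<one>\<^bsub>K\<^esub> \<in> N"
  shows "\<exists>V. openin \<tau> V \<and> \<one>\<^bsub>K\<^esub> \<in> V \<and> (\<forall>a\<in>V. \<forall>b\<in>V. \<forall>c\<in>V. a \<otimes>\<^bsub>K\<^esub> (b \<otimes>\<^bsub>K\<^esub> c) \<in> N)"
proof -
  interpret group K by fact
  have square: "\<exists>V. openin \<tau> V \<and> \<one>\<^bsub>K\<^esub> \<in> V \<and> (\<forall>a\<in>V. \<forall>b\<in>V. a \<otimes>\<^bsub>K\<^esub> b \<in> M)"
    if M: "openin \<tau> M" "\<one>\<^bsub>K\<^esub> \<in> M" for M
  proof -
    let ?P = "{p \<in> topspace (prod_topology \<tau> \<tau>). (\<lambda>(x, y). x \<otimes>\<^bsub>K\<^esub> y) p \<in> M}"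
    have "openin (prod_topology \<tau> \<tau>) ?P"
      using \<tau> M(1) by (intro openin_continuous_map_preimage) (auto simp: semigroup_topology_def)
    moreover have "(\<one>\<^bsub>K\<^esub>, \<one>\<^bsub>K\<^esub>) \<in> ?P"
      using \<tau> M(2) by (simp add: semigroup_topology_def)
    ultimately obtain U V where UV: "openin \<tau> U" "openin \<tau> V" "\<one>\<^bsub>K\<^esub> \<in> U" "\<one>\<^bsub>K\<^esub> \<in> V" "U \<times> V \<subseteq> ?P"
      unfolding openin_prod_topology_alt by meson
    then show ?thesis by (intro exI[of _ "U \<inter> V"]) auto
  qed
  obtain M where M: "openin \<tau> M" "\<one>\<^bsub>K\<^esub> \<in> M" "\<forall>a\<in>M. \<forall>b\<in>M. a \<otimes>\<^bsub>K\<^esub> b \<in> N"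
    using square[OF N] by blast
  obtain V where V: "openin \<tau> V" "\<one>\<^bsub>K\<^esub> \<in> V" "\<forall>a\<in>V. \<forall>b\<in>V. a \<otimes>\<^bsub>K\<^esub> b \<in> M"
    using square[OF M(1,2)] by blast
  have "V \<subseteq> M"
  proof
    fix a assume a: "a \<in> V"
    then have "a \<in> carrier K" using openin_subset[OF V(1)] \<tau> by (auto simp: semigroup_topology_def)
    then have "a = a \<otimes>\<^bsub>K\<^esub> \<one>\<^bsub>K\<^esub>" by simp
    then show "a \<in> M" using V(2,3) a by metis
  qed
  then have "\<forall>a\<in>V. \<forall>b\<in>V. \<forall>c\<in>V. a \<otimes>\<^bsub>K\<^esub> (b \<otimes>\<^bsub>K\<^esub> c) \<in> N"
    using M(3) V(3) by blast
  with V(1,2) show ?thesis by blast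
qed

text \<open>An order isomorphism from the rationals onto the positive rationals. Shifting it by \<open>b\<close>, or
  reflecting it at \<open>0\<close>, gives copies of the rationals above \<open>b\<close> and below \<open>0\<close>.\<close>

definition rat_stretch :: "rat \<Rightarrow> rat" where
  "rat_stretch q = (if q \<le> 0 then 1 / (1 - q) else q + 1)"

lemma rat_stretch_pos: "0 < rat_stretch q"
  by (auto simp: rat_stretch_def)

lemma rat_stretch_less: "p < q \<Longrightarrow> rat_stretch p < rat_stretch q"
proof -
  assume pq: "p < q"
  consider "q \<le> 0" | "p \<le> 0" "0 < q" | "0 < p" by linarith
  then show ?thesis
  proof cases
    case 1
    with pq show ?thesis by (simp add: rat_stretch_def divide_strict_left_mono)
  next
    case 2
    then have "1 / (1 - p) \<le> 1" by simp
    also have "1 < q + 1" using 2 by simp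
    finally show ?thesis using 2 by (simp add: rat_stretch_def)
  next
    case 3
    with pq show ?thesis by (simp add: rat_stretch_def)
  qed
qed

lemma sorted_wrt_map_less:
  assumes "\<And>p q. p < q \<Longrightarrow> \<phi> p < \<phi> q" "sorted_wrt (<) (qs :: rat list)"
  shows "sorted_wrt (<) (map \<phi> qs :: rat list)"
  using assms sorted_wrt_mono_rel[of qs "(<)" "\<lambda>p q. \<phi> p < \<phi> q"] by (simp add: sorted_wrt_map)

section \<open>The topology generated by a filter base\<close>

locale group_filter_base = group K for K :: "('k, 'm) monoid_scheme" (structure) +
  fixes F :: "'k set set"
  assumes nonempty: "F \<noteq> {}"
    and sub_carrier: "A \<in> F \<Longrightarrow> A \<subseteq> carrier K"
    and directed: "A \<in> F \<Longrightarrow> B \<in> F \<Longrightarrow> \<exists>C\<in>F. C \<subseteq> A \<inter> B"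
begin

lemma conj_familyI:
  assumes "\<And>g. g \<in> carrier K \<Longrightarrow> S g \<in> F"
  shows "{g \<otimes> s \<otimes> inv g | g s. g \<in> carrier K \<and> s \<in> S g} \<in> conj_family K F"
  unfolding conj_family_def l_coset_def r_coset_def using assms by (auto intro!: exI[of _ S])

lemma conj_familyE:
  assumes "A \<in> conj_family K F"
  obtains S where "\<And>g. g \<in> carrier K \<Longrightarrow> S g \<in> F"
    "A = {g \<otimes> s \<otimes> inv g | g s. g \<in> carrier K \<and> s \<in> S g}"
  using assms unfolding conj_family_def l_coset_def r_coset_def by fastforce

lemma conj_family_subset:
  assumes "A \<in> conj_family K F" shows "A \<subseteq> carrier K"
proof -
  obtain S where S: "\<And>g. g \<in> carrier K \<Longrightarrow> S g \<in> F"
    and A: "A = {g \<otimes> s \<otimes> inv g | g s. g \<in> carrier K \<and> s \<in> S g}"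
    using conj_familyE[OF assms] by blast
  show ?thesis unfolding A using S sub_carrier by blast
qed

lemma conj_family_nonempty: "conj_family K F \<noteq> {}"
  using nonempty unfolding conj_family_def by fast

text \<open>The conjugate by the neutral element is one of the sets in the union.\<close>

lemma conj_family_superset:
  assumes "A \<in> conj_family K F" shows "\<exists>B\<in>F. B \<subseteq> A"
proof -
  obtain S where S: "\<And>g. g \<in> carrier K \<Longrightarrow> S g \<in> F"
    and A: "A = {g \<otimes> s \<otimes> inv g | g s. g \<in> carrier K \<and> s \<in> S g}"
    using conj_familyE[OF assms] by blast
  have "S \<one> \<subseteq> A"
  proof
    fix s assume s: "s \<in> S \<one>"
    then have "s \<in> carrier K" using S[OF one_closed] sub_carrier by blast
    then have "s = \<one> \<otimes> s \<otimes> inv \<one>" by simp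
    with s show "s \<in> A" unfolding A using one_closed by blast
  qed
  with S[OF one_closed] show ?thesis by blast
qed

lemma conj_family_directed:
  assumes "A \<in> conj_family K F" "B \<in> conj_family K F"
  shows "\<exists>C\<in>conj_family K F. C \<subseteq> A \<inter> B"
proof -
  obtain S where S: "\<And>g. g \<in> carrier K \<Longrightarrow> S g \<in> F"
    and A: "A = {g \<otimes> s \<otimes> inv g | g s. g \<in> carrier K \<and> s \<in> S g}"
    using conj_familyE[OF assms(1)] by blast
  obtain T where T: "\<And>g. g \<in> carrier K \<Longrightarrow> T g \<in> F"
    and B: "B = {g \<otimes> s \<otimes> inv g | g s. g \<in> carrier K \<and> s \<in> T g}"
    using conj_familyE[OF assms(2)] by blast
  have "\<forall>g\<in>carrier K. \<exists>C\<in>F. C \<subseteq> S g \<inter> T g"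
    using S T directed by blast
  then obtain C where C: "\<forall>g\<in>carrier K. C g \<in> F \<and> C g \<subseteq> S g \<inter> T g"
    by metis
  show ?thesis
  proof (rule bexI[OF _ conj_familyI])
    show "{g \<otimes> s \<otimes> inv g | g s. g \<in> carrier K \<and> s \<in> C g} \<subseteq> A \<inter> B"
      unfolding A B using C by blast
  qed (use C in blast)
qed

text \<open>Conjugation by \<open>y\<close> permutes the conjugating elements: \<open>y (g S\<^sub>g g\<^sup>-\<^sup>1) y\<^sup>-\<^sup>1\<close> is the conjugate of
  \<open>S\<^sub>g\<close> by \<open>h = y g\<close>, so reindexing the tuple as \<open>h \<mapsto> S\<close> at \<open>y\<^sup>-\<^sup>1 h\<close> stays in the family. This is what
  makes left and right translation interchangeable for the topology.\<close>

lemma conj_family_conjugate: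
  assumes "A \<in> conj_family K F" "y \<in> carrier K"
  shows "{s \<in> carrier K. inv y \<otimes> s \<otimes> y \<in> A} \<in> conj_family K F"
proof -
  obtain S where S: "\<And>g. g \<in> carrier K \<Longrightarrow> S g \<in> F"
    and A: "A = {g \<otimes> s \<otimes> inv g | g s. g \<in> carrier K \<and> s \<in> S g}"
    using conj_familyE[OF assms(1)] by blast
  let ?B = "{h \<otimes> s \<otimes> inv h | h s. h \<in> carrier K \<and> s \<in> S (inv y \<otimes> h)}"
  have "?B = {s \<in> carrier K. inv y \<otimes> s \<otimes> y \<in> A}"
  proof (intro equalityI subsetI)
    fix x assume "x \<in> ?B"
    then obtain h s where h: "x = h \<otimes> s \<otimes> inv h" "h \<in> carrier K" "s \<in> S (inv y \<otimes> h)" by blast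
    have s: "s \<in> carrier K" using h S sub_carrier assms(2) by (meson inv_closed m_closed subsetD)
    have "inv y \<otimes> x \<otimes> y = (inv y \<otimes> h) \<otimes> s \<otimes> inv (inv y \<otimes> h)"
      using h s assms(2) by (simp add: m_assoc inv_mult_group)
    moreover have "inv y \<otimes> h \<in> carrier K" using h assms by simp
    ultimately have "inv y \<otimes> x \<otimes> y \<in> A" unfolding A using h(3) by blast
    then show "x \<in> {s \<in> carrier K. inv y \<otimes> s \<otimes> y \<in> A}" using h s by simp
  next
    fix x assume "x \<in> {s \<in> carrier K. inv y \<otimes> s \<otimes> y \<in> A}"
    then obtain g s where x: "x \<in> carrier K"
      and g: "inv y \<otimes> x \<otimes> y = g \<otimes> s \<otimes> inv g" "g \<in> carrier K" "s \<in> S g" unfolding A by blast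
    have s: "s \<in> carrier K" using g S sub_carrier by blast
    have "x = y \<otimes> (inv y \<otimes> x \<otimes> y) \<otimes> inv y"
      using x assms(2) by (simp add: m_assoc inv_solve_left')
        (simp add: m_assoc[symmetric])
    also have "\<dots> = (y \<otimes> g) \<otimes> s \<otimes> inv (y \<otimes> g)"
      unfolding g(1) using g s assms(2) by (simp add: m_assoc inv_mult_group)
    finally have "x = (y \<otimes> g) \<otimes> s \<otimes> inv (y \<otimes> g)" .
    moreover have "y \<otimes> g \<in> carrier K" "s \<in> S (inv y \<otimes> (y \<otimes> g))"
      using g assms(2) by (simp_all add: m_assoc[symmetric])
    ultimately show "x \<in> ?B" by blast
  qed
  moreover have "?B \<in> conj_family K F"
    by (rule conj_familyI) (use S assms(2) in simp)
  ultimately show ?thesis by simp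
qed

definition conj_tuple :: "(rat \<Rightarrow> 'k set) \<Rightarrow> bool" where
  "conj_tuple S \<longleftrightarrow> (\<forall>q. S q \<in> conj_family K F)"

lemma conj_tuple_subset: "conj_tuple S \<Longrightarrow> S q \<subseteq> carrier K"
  using conj_family_subset by (auto simp: conj_tuple_def)

lemma conj_tuple_comp: "conj_tuple S \<Longrightarrow> conj_tuple (S \<circ> \<phi>)"
  by (simp add: conj_tuple_def)

lemma ordered_product_subset:
  assumes "\<And>q. S q \<subseteq> carrier K" shows "ordered_product K S qs \<subseteq> carrier K"
proof (induction qs)
  case (Cons q qs)
  then show ?case using set_mult_closed[of "S q \<union> {\<one>}"] assms by simp
qed simp

lemma ordered_product_append:
  assumes "\<And>q. S q \<subseteq> carrier K"
  shows "ordered_product K S (qs @ rs) = ordered_product K S qs <#> ordered_product K S rs"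
proof (induction qs)
  case Nil
  have "{\<one>} <#> A = A" if "A \<subseteq> carrier K" for A
    using that by (force simp: set_mult_def)
  then show ?case using ordered_product_subset[where S = S and qs = rs, OF assms] by simp
next
  case (Cons q qs)
  then show ?case
    using assms ordered_product_subset[where S = S, OF assms]
    by (simp add: set_mult_assoc)
qed

lemma ordered_product_mono:
  assumes "\<And>q. S q \<subseteq> T q" shows "ordered_product K S qs \<subseteq> ordered_product K T qs"
proof (induction qs)
  case (Cons q qs)
  have "S q \<union> {\<one>} \<subseteq> T q \<union> {\<one>}" using assms by blast
  from mono_set_mult[OF this Cons.IH] show ?case by simp
qed simp

lemma ordered_product_one: "\<one> \<in> ordered_product K S qs"
proof (induction qs)
  case (Cons q qs)
  then have "\<one> \<otimes> \<one> \<in> ordered_product K S (q # qs)"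
    unfolding set_mult_def foldr_Cons o_apply by blast
  then show ?case by simp
qed simp

lemma U'_eq: "U' K S = (\<Union>qs\<in>{qs. sorted_wrt (<) qs}. ordered_product K S qs)"
  by (simp add: U'_def)

lemma one_in_U': "\<one> \<in> U' K S"
  unfolding U'_eq using ordered_product_one by (auto intro!: exI[of _ "[]"])

lemma U'_subset: "conj_tuple S \<Longrightarrow> U' K S \<subseteq> carrier K"
  unfolding U'_eq by (intro UN_least ordered_product_subset conj_tuple_subset)

lemma U'_superset: 
  assumes "conj_tuple S" shows "\<exists>B\<in>F. B \<subseteq> U' K S"
proof -
  have "S 0 \<subseteq> ordered_product K S [0]" 
    using conj_tuple_subset[OF assms, of 0] by (fastforce simp: set_mult_def)
  moreover have "\<dots> \<subseteq> U' K S" unfolding U'_eq by (intro UN_upper) simp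
  moreover have "\<exists>B\<in>F. B \<subseteq> S 0" using assms by (intro conj_family_superset) (simp add: conj_tuple_def)
  ultimately show ?thesis by blast
qed

lemma U'_directed:
  assumes "conj_tuple S" "conj_tuple T"
  shows "\<exists>C. conj_tuple C \<and> U' K C \<subseteq> U' K S \<inter> U' K T"
proof -
  have "\<forall>q. \<exists>C\<in>conj_family K F. C \<subseteq> S q \<inter> T q"
    using assms conj_family_directed by (simp add: conj_tuple_def)
  then obtain C where C: "\<And>q. C q \<in> conj_family K F \<and> C q \<subseteq> S q \<inter> T q" by metis
  have "ordered_product K C qs \<subseteq> ordered_product K S qs \<inter> ordered_product K T qs" for qs
    using ordered_product_mono[of C S] ordered_product_mono[of C T] C by blast
  then have "U' K C \<subseteq> U' K S \<inter> U' K T" unfolding U'_eq by blast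
  with C show ?thesis by (auto simp: conj_tuple_def)
qed

text \<open>Conjugation is a homomorphism, so it may be applied factor by factor to an ordered product.\<close>

lemma U'_conjugate:
  assumes "conj_tuple S" "y \<in> carrier K"
  shows "\<exists>T. conj_tuple T \<and> (\<forall>u\<in>U' K T. inv y \<otimes> u \<otimes> y \<in> U' K S)"
proof -
  define T where "T q = {s \<in> carrier K. inv y \<otimes> s \<otimes> y \<in> S q}" for q
  have T: "conj_tuple T"
    using assms conj_family_conjugate by (simp add: conj_tuple_def T_def)
  have "inv y \<otimes> u \<otimes> y \<in> ordered_product K S qs" if "u \<in> ordered_product K T qs" for u qs
    using that
  proof (induction qs arbitrary: u)
    case Nil
    then show ?case using assms by simp
  next
    case (Cons q qs)
    then obtain a b where ab: "u = a \<otimes> b" "a \<in> T q \<union> {\<one>}" "b \<in> ordered_product K T qs"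
      by (auto simp: set_mult_def)
    have c: "a \<in> carrier K" "b \<in> carrier K"
      using ab ordered_product_subset[where S = T and qs = qs, OF conj_tuple_subset[OF T]]
      by (auto simp: T_def)
    have "inv y \<otimes> u \<otimes> y = (inv y \<otimes> a \<otimes> y) \<otimes> (inv y \<otimes> b \<otimes> y)"
    proof -
      have "y \<otimes> (inv y \<otimes> (b \<otimes> y)) = b \<otimes> y"
        using c assms(2) by (simp add: m_assoc[symmetric])
      then show ?thesis using c assms(2) ab(1) by (simp add: m_assoc)
    qed
    moreover have "inv y \<otimes> a \<otimes> y \<in> S q \<union> {\<one>}"
      using ab(2) assms(2) by (auto simp: T_def)
    ultimately show ?case using Cons.IH[OF ab(3)] by (auto simp: set_mult_def)
  qed
  then have "\<forall>u\<in>U' K T. inv y \<otimes> u \<otimes> y \<in> U' K S" unfolding U'_eq by blast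
  with T show ?thesis by blast
qed

lemma ordered_product_reindex:
  "ordered_product K (S \<circ> \<phi>) qs = ordered_product K S (map \<phi> qs)"
  by (simp add: foldr_map o_def)

text \<open>A point of the set uses only finitely many indices, and above the largest of them there is still
  an order copy of all the rationals. This is the reason for indexing by a dense order without
  endpoints: \<open>U' K S\<close> is a neighbourhood of each of its points, not only of the neutral element.\<close>

lemma U'_open:
  assumes "conj_tuple S" "x \<in> U' K S"
  shows "\<exists>T. conj_tuple T \<and> (\<forall>u\<in>U' K T. x \<otimes> u \<in> U' K S)"
proof -
  obtain qs where qs: "sorted_wrt (<) qs" "x \<in> ordered_product K S qs"
    using assms(2) unfolding U'_eq by blast
  obtain b where b: "\<forall>q\<in>set qs. q \<le> b"
    by (metis Max_ge finite_set)
  define \<phi> where "\<phi> q = b + rat_stretch q" for q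
  have less: "p < q \<Longrightarrow> \<phi> p < \<phi> q" for p q
    by (simp add: \<phi>_def rat_stretch_less)
  have gt: "b < \<phi> q" for q
    using rat_stretch_pos[of q] by (simp add: \<phi>_def)
  have "x \<otimes> u \<in> U' K S" if u: "u \<in> U' K (S \<circ> \<phi>)" for u
  proof -
    obtain rs where rs: "sorted_wrt (<) rs" "u \<in> ordered_product K S (map \<phi> rs)"
      using u unfolding U'_eq ordered_product_reindex by blast
    have "sorted_wrt (<) (qs @ map \<phi> rs)"
      using qs(1) sorted_wrt_map_less[OF less rs(1)] b gt
      by (auto simp: sorted_wrt_append intro: le_less_trans)
    moreover have "x \<otimes> u \<in> ordered_product K S (qs @ map \<phi> rs)"
      unfolding ordered_product_append[where S = S, OF conj_tuple_subset[OF assms(1)]]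
      using qs(2) rs(2) by (rule set_multI)
    ultimately show ?thesis unfolding U'_eq by blast
  qed
  then show ?thesis using conj_tuple_comp[OF assms(1)] by blast
qed

text \<open>The negative and the positive rationals are both order copies of the rationals, and a product over
  negative indices followed by one over positive indices is again in increasing order.\<close>

lemma U'_split:
  assumes "conj_tuple S"
  shows "\<exists>T T'. conj_tuple T \<and> conj_tuple T' \<and> (\<forall>u\<in>U' K T. \<forall>v\<in>U' K T'. u \<otimes> v \<in> U' K S)"
proof -
  define \<psi> where "\<psi> q = - rat_stretch (- q)" for q
  have less: "p < q \<Longrightarrow> \<psi> p < \<psi> q" for p q
    by (simp add: \<psi>_def rat_stretch_less)
  have lt: "\<psi> p < rat_stretch q" for p q
    using rat_stretch_pos[of q] rat_stretch_pos[of "- p"] by (simp add: \<psi>_def)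
  have "u \<otimes> v \<in> U' K S" if uv: "u \<in> U' K (S \<circ> \<psi>)" "v \<in> U' K (S \<circ> rat_stretch)" for u v
  proof -
    obtain qs where qs: "sorted_wrt (<) qs" "u \<in> ordered_product K S (map \<psi> qs)"
      using uv(1) unfolding U'_eq ordered_product_reindex by blast
    obtain rs where rs: "sorted_wrt (<) rs" "v \<in> ordered_product K S (map rat_stretch rs)"
      using uv(2) unfolding U'_eq ordered_product_reindex by blast
    have "sorted_wrt (<) (map \<psi> qs @ map rat_stretch rs)"
      using sorted_wrt_map_less[OF less qs(1)] sorted_wrt_map_less[OF rat_stretch_less rs(1)] lt
      by (auto simp: sorted_wrt_append)
    moreover have "u \<otimes> v \<in> ordered_product K S (map \<psi> qs @ map rat_stretch rs)"
      unfolding ordered_product_append[where S = S, OF conj_tuple_subset[OF assms]]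
      using qs(2) rs(2) by (rule set_multI)
    ultimately show ?thesis unfolding U'_eq by blast
  qed
  then show ?thesis using conj_tuple_comp[OF assms] by blast
qed

lemma openin_coset_U':
  "conj_tuple S \<Longrightarrow> z \<in> carrier K \<Longrightarrow> openin (T'_fam K F) (z <# U' K S)"
  unfolding T'_fam_def by (intro topology_generated_by_Basis) (auto simp: conj_tuple_def)

lemma mem_coset_U': "z \<in> carrier K \<Longrightarrow> z \<in> z <# U' K S"
  using one_in_U'[of S] by (force simp: l_coset_def)

text \<open>The left cosets of the sets \<open>U' K S\<close> form a basis, not only a subbasis, by
  \<open>U'_open\<close> and \<open>U'_directed\<close>.\<close>

lemma openin_T'_fam:
  "openin (T'_fam K F) W \<longleftrightarrow>
     W \<subseteq> carrier K \<and> (\<forall>z\<in>W. \<exists>S. conj_tuple S \<and> (\<forall>u\<in>U' K S. z \<otimes> u \<in> W))"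
  (is "_ \<longleftrightarrow> ?R W")
proof
  let ?B = "{x <# U' K S | x S. x \<in> carrier K \<and> (\<forall>q. S q \<in> conj_family K F)}"
  assume "openin (T'_fam K F) W"
  then have "generate_topology_on ?B W"
    by (simp add: T'_fam_def openin_topology_generated_by_iff)
  then show "?R W"
  proof induction
    case Empty
    then show ?case by simp
  next
    case (Int V W)
    show ?case
    proof (intro conjI ballI)
      show "V \<inter> W \<subseteq> carrier K" using Int by blast
      fix z assume z: "z \<in> V \<inter> W"
      obtain S where S: "conj_tuple S" "\<forall>u\<in>U' K S. z \<otimes> u \<in> V" using z Int by blast
      obtain T where T: "conj_tuple T" "\<forall>u\<in>U' K T. z \<otimes> u \<in> W" using z Int by blast
      show "\<exists>S. conj_tuple S \<and> (\<forall>u\<in>U' K S. z \<otimes> u \<in> V \<inter> W)"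
        using U'_directed[OF S(1) T(1)] S(2) T(2) by blast
    qed
  next
    case (UN \<W>)
    then show ?case by (metis Union_iff Union_least)
  next
    case (Basis W)
    then obtain x S where x: "W = x <# U' K S" "x \<in> carrier K" "conj_tuple S"
      by (auto simp: conj_tuple_def)
    show ?case
    proof (intro conjI ballI)
      show "W \<subseteq> carrier K"
        using x U'_subset[OF x(3)] by (auto simp: l_coset_def)
      fix z assume "z \<in> W"
      then obtain v where v: "v \<in> U' K S" "z = x \<otimes> v" by (auto simp: x(1) l_coset_def)
      obtain T where T: "conj_tuple T" "\<forall>u\<in>U' K T. v \<otimes> u \<in> U' K S"
        using U'_open[OF x(3) v(1)] by blast
      have "z \<otimes> u \<in> W" if "u \<in> U' K T" for u
      proof -
        have "z \<otimes> u = x \<otimes> (v \<otimes> u)"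
          using v x(2) U'_subset[OF x(3)] U'_subset[OF T(1)] that by (simp add: subset_iff m_assoc)
        then show ?thesis using T(2) that by (auto simp: x(1) l_coset_def)
      qed
      with T(1) show "\<exists>S. conj_tuple S \<and> (\<forall>u\<in>U' K S. z \<otimes> u \<in> W)" by blast
    qed
  qed
next
  assume R: "?R W"
  show "openin (T'_fam K F) W"
  proof (subst openin_subopen, intro ballI)
    fix z assume z: "z \<in> W"
    then obtain S where S: "conj_tuple S" "\<forall>u\<in>U' K S. z \<otimes> u \<in> W" using R by blast
    have zc: "z \<in> carrier K" using z R by blast
    have "z <# U' K S \<subseteq> W" using S(2) by (auto simp: l_coset_def)
    then show "\<exists>T. openin (T'_fam K F) T \<and> z \<in> T \<and> T \<subseteq> W"
      using openin_coset_U'[OF S(1) zc] mem_coset_U'[OF zc] by blast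
  qed
qed

lemma ex_conj_tuple: "\<exists>S. conj_tuple S"
proof -
  obtain A where "A \<in> conj_family K F" using conj_family_nonempty by blast
  then show ?thesis by (auto simp: conj_tuple_def intro!: exI[of _ "\<lambda>_. A"])
qed

lemma topspace_T'_fam: "topspace (T'_fam K F) = carrier K"
proof
  show "topspace (T'_fam K F) \<subseteq> carrier K"
    using openin_T'_fam by blast
  have "openin (T'_fam K F) (carrier K)"
    unfolding openin_T'_fam using ex_conj_tuple U'_subset by (meson m_closed order_refl subsetD)
  then show "carrier K \<subseteq> topspace (T'_fam K F)" by (rule openin_subset)
qed

text \<open>For \<open>u\<close>, \<open>v\<close> near the neutral element, \<open>(x u) (y v) = x y (y\<^sup>-\<^sup>1 u y) v\<close>. Closure of the
  neighbourhoods under conjugation takes care of \<open>y\<^sup>-\<^sup>1 u y\<close>, and splitting the index set takes care of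
  the product.\<close>

lemma semigroup_topology_T'_fam: "semigroup_topology K (T'_fam K F)"
  unfolding semigroup_topology_def
proof (intro conjI topspace_T'_fam)
  let ?T = "T'_fam K F"
  show "continuous_map (prod_topology ?T ?T) ?T (\<lambda>(x, y). x \<otimes> y)"
    unfolding continuous_map_def
  proof (intro conjI allI impI)
    show "(\<lambda>(x, y). x \<otimes> y) \<in> topspace (prod_topology ?T ?T) \<rightarrow> topspace ?T"
      by (auto simp: topspace_T'_fam)
    fix W assume W: "openin ?T W"
    define P where "P = {p \<in> topspace (prod_topology ?T ?T). (\<lambda>(x, y). x \<otimes> y) p \<in> W}"
    show "openin (prod_topology ?T ?T) P"
      unfolding openin_prod_topology_alt
    proof (intro allI impI)
      fix x y assume "(x, y) \<in> P"
      then have xy: "x \<in> carrier K" "y \<in> carrier K" "x \<otimes> y \<in> W"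
        by (auto simp: P_def topspace_T'_fam)
      obtain S where S: "conj_tuple S" "\<forall>u\<in>U' K S. x \<otimes> y \<otimes> u \<in> W"
        using W xy(3) unfolding openin_T'_fam by blast
      obtain T T' where T: "conj_tuple T" "conj_tuple T'"
        "\<forall>u\<in>U' K T. \<forall>v\<in>U' K T'. u \<otimes> v \<in> U' K S"
        using U'_split[OF S(1)] by blast
      obtain C where C: "conj_tuple C" "\<forall>u\<in>U' K C. inv y \<otimes> u \<otimes> y \<in> U' K T"
        using U'_conjugate[OF T(1) xy(2)] by blast
      have "(x <# U' K C) \<times> (y <# U' K T') \<subseteq> P"
      proof (clarify)
        fix a b assume a: "a \<in> x <# U' K C" and b: "b \<in> y <# U' K T'"
        obtain u where u: "u \<in> U' K C" "a = x \<otimes> u" using a by (auto simp: l_coset_def)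
        obtain v where v: "v \<in> U' K T'" "b = y \<otimes> v" using b by (auto simp: l_coset_def)
        have c: "u \<in> carrier K" "v \<in> carrier K"
          using u v U'_subset[OF C(1)] U'_subset[OF T(2)] by auto
        have "y \<otimes> (inv y \<otimes> (u \<otimes> (y \<otimes> v))) = u \<otimes> (y \<otimes> v)"
          using c xy by (simp add: m_assoc[symmetric])
        then have "a \<otimes> b = x \<otimes> y \<otimes> ((inv y \<otimes> u \<otimes> y) \<otimes> v)"
          using c xy u v by (simp add: m_assoc)
        moreover have "(inv y \<otimes> u \<otimes> y) \<otimes> v \<in> U' K S"
          using C(2) T(3) u v by blast
        ultimately have "a \<otimes> b \<in> W" using S(2) by simp
        then show "(a, b) \<in> P"
          using c xy u v by (simp add: P_def topspace_T'_fam)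
      qed
      then show "\<exists>U V. openin ?T U \<and> openin ?T V \<and> x \<in> U \<and> y \<in> V \<and> U \<times> V \<subseteq> P"
        using openin_coset_U'[OF C(1) xy(1)] openin_coset_U'[OF T(2) xy(2)]
          mem_coset_U' xy(1,2)
        by (intro exI[of _ "x <# U' K C"] exI[of _ "y <# U' K T'"]) simp
    qed
  qed
qed

lemma T'_fam_converges:
  assumes "openin (T'_fam K F) W" "z \<in> W"
  shows "\<exists>A\<in>F. \<forall>a\<in>A. z \<otimes> a \<in> W"
proof -
  obtain S where S: "conj_tuple S" "\<forall>u\<in>U' K S. z \<otimes> u \<in> W"
    using assms unfolding openin_T'_fam by blast
  then show ?thesis using U'_superset[OF S(1)] by blast
qed

text \<open>Split the product at the factor of smallest index \<open>m\<close>: the parts to the left and to the right have only larger indices, so by induction each of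
  the three pieces lies in \<open>N\<^sub>m\<^sub>+\<^sub>1\<close>, and the whole in \<open>N\<^sub>m\<close>. A triple product suffices because the indices
  are distinct.\<close>

lemma ordered_product_bound:
  assumes NK: "\<And>n. N n \<subseteq> carrier K"
    and N1: "\<And>n. \<one> \<in> N n"
    and N3: "\<And>n a b c. a \<in> N (Suc n) \<Longrightarrow> b \<in> N (Suc n) \<Longrightarrow> c \<in> N (Suc n) \<Longrightarrow> a \<otimes> (b \<otimes> c) \<in> N n"
    and S: "\<And>q. S q \<subseteq> N (Suc (i q))" and inj: "inj i"
    and "distinct qs" "\<forall>q\<in>set qs. n \<le> i q"
  shows "ordered_product K S qs \<subseteq> N n"
  using \<open>distinct qs\<close> \<open>\<forall>q\<in>set qs. n \<le> i q\<close>
proof (induction qs arbitrary: n rule: length_induct)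
  case (1 qs)
  \<comment> \<open>The chain decreases: insert the neutral element twice into a triple product.\<close>
  have anti: "N k \<subseteq> N m" if "m \<le> k" for m k
    using that
  proof (rule lift_Suc_antimono_le[rotated])
    fix k
    show "N (Suc k) \<subseteq> N k"
    proof
      fix a assume a: "a \<in> N (Suc k)"
      then have "a \<otimes> (\<one> \<otimes> \<one>) \<in> N k" using N1 N3 by blast
      then show "a \<in> N k" using a NK by force
    qed
  qed
  show ?case
  proof (cases "qs = []")
    case True
    then show ?thesis using N1 by simp
  next
    case False
    define m where "m = Min (i ` set qs)"
    have "m \<in> i ` set qs" unfolding m_def using False by (intro Min_in) auto
    then obtain q where q: "q \<in> set qs" "m = i q" by blast
    have min: "m \<le> i p" if "p \<in> set qs" for p
      unfolding m_def using that by simp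
    obtain l r where lr: "qs = l @ q # r" using q(1) by (meson split_list)
    have later: "Suc m \<le> i p" if "p \<in> set l \<union> set r" for p
    proof -
      have "p \<noteq> q" using that 1(2) lr by auto
      then have "i p \<noteq> m" using q(2) inj by (simp add: inj_eq)
      then show ?thesis using min[of p] that lr by auto
    qed
    have l: "ordered_product K S l \<subseteq> N (Suc m)" and r: "ordered_product K S r \<subseteq> N (Suc m)"
      using 1(1)[rule_format, of l "Suc m"] 1(1)[rule_format, of r "Suc m"] 1(2) lr later by auto
    have "S q \<union> {\<one>} \<subseteq> N (Suc m)" using S[of q] q(2) N1 by blast
    moreover have "S p \<subseteq> carrier K" for p using S NK by blast
    ultimately have "ordered_product K S qs
        = ordered_product K S l <#> ((S q \<union> {\<one>}) <#> ordered_product K S r)"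
      unfolding lr by (subst ordered_product_append) auto
    moreover have "\<dots> \<subseteq> N (Suc m) <#> (N (Suc m) <#> N (Suc m))"
      using l r \<open>S q \<union> {\<one>} \<subseteq> N (Suc m)\<close> by (intro mono_set_mult)
    moreover have "\<dots> \<subseteq> N m" using N3 by (auto simp: set_mult_def)
    ultimately have "ordered_product K S qs \<subseteq> N m" by simp
    moreover have "n \<le> m" using 1(3) q by blast
    ultimately show ?thesis using anti by blast
  qed
qed

text \<open>Translate \<open>W\<close> to a neighbourhood of the neutral element, take the chain of cube roots below it, and
  enumerate the rationals: if \<open>q\<close> is the \<open>n\<close>-th rational, its set is chosen inside \<open>N\<^sub>n\<^sub>+\<^sub>1\<close>, so that
  \<open>ordered_product_bound\<close> keeps every ordered product inside \<open>W\<close>.\<close>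

theorem T'_fam_finest:
  assumes \<tau>: "semigroup_topology K \<tau>"
    and conv: "\<And>V. openin \<tau> V \<Longrightarrow> \<one> \<in> V \<Longrightarrow> \<exists>A\<in>F. A \<subseteq> V"
    and W: "openin \<tau> W"
  shows "openin (T'_fam K F) W"
  unfolding openin_T'_fam
proof (intro conjI ballI)
  have top: "topspace \<tau> = carrier K" using \<tau> by (simp add: semigroup_topology_def)
  show "W \<subseteq> carrier K" using openin_subset[OF W] top by simp
  have cont: "continuous_map \<tau> \<tau> (\<lambda>x. a \<otimes> x \<otimes> b)" if "a \<in> carrier K" "b \<in> carrier K" for a b
    using that by (intro semigroup_topology_times[OF \<tau>]) (auto simp: top)
  \<comment> \<open>Each conjugation is continuous for \<open>\<tau>\<close>, so \<open>S g\<close> can be chosen with \<open>g S\<^sub>g g\<^sup>-\<^sup>1\<close> inside \<open>V\<close>.\<close>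
  have inK: "\<exists>A\<in>conj_family K F. A \<subseteq> V" if V: "openin \<tau> V" "\<one> \<in> V" for V
  proof -
    have "\<exists>A\<in>F. A \<subseteq> {x \<in> topspace \<tau>. g \<otimes> x \<otimes> inv g \<in> V}" if "g \<in> carrier K" for g
      using that V top by (intro conv openin_continuous_map_preimage[OF cont]) auto
    then obtain S where S: "\<And>g. g \<in> carrier K \<Longrightarrow> S g \<in> F \<and> S g \<subseteq> {x \<in> topspace \<tau>. g \<otimes> x \<otimes> inv g \<in> V}"
      by metis
    show ?thesis
      by (rule bexI[OF _ conj_familyI[of S]]) (use S in blast)+
  qed
  fix z assume z: "z \<in> W"
  have zc: "z \<in> carrier K" using z openin_subset[OF W] top by blast
  \<comment> \<open>The translate of \<open>W\<close> by the inverse of \<open>z\<close>; the trailing factor fits the form of \<open>cont\<close>.\<close>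
  define V where "V = {x \<in> topspace \<tau>. z \<otimes> x \<otimes> \<one> \<in> W}"
  have V: "openin \<tau> V" "\<one> \<in> V"
    unfolding V_def using openin_continuous_map_preimage[OF cont[OF zc one_closed] W] zc z top
    by simp_all
  define P where "P n M \<longleftrightarrow> openin \<tau> M \<and> \<one> \<in> M \<and> (n = 0 \<longrightarrow> M = V)" for n :: nat and M
  define Q where "Q M M' \<longleftrightarrow> (\<forall>a\<in>M'. \<forall>b\<in>M'. \<forall>c\<in>M'. a \<otimes> (b \<otimes> c) \<in> M)" for M M'
  obtain N where P: "\<And>n. P n (N n)" and Q: "\<And>n. Q (N n) (N (Suc n))"
  proof (rule dependent_nat_choice[of P "\<lambda>_. Q", THEN exE])
    show "\<exists>M. P 0 M" using V by (simp add: P_def)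
    show "\<exists>M'. P (Suc n) M' \<and> Q M M'" if "P n M" for n M
      using semigroup_topology_cube_root[OF \<tau> group_axioms, of M] that by (simp add: P_def Q_def)
  qed blast
  have N0: "N 0 = V" and N: "\<And>n. openin \<tau> (N n)" "\<And>n. \<one> \<in> N n"
    "\<And>n a b c. a \<in> N (Suc n) \<Longrightarrow> b \<in> N (Suc n) \<Longrightarrow> c \<in> N (Suc n) \<Longrightarrow> a \<otimes> (b \<otimes> c) \<in> N n"
    using P Q by (auto simp: P_def Q_def)
  \<comment> \<open>The successor leaves room for one triple product at the smallest index of a list.\<close>
  have "\<forall>q::rat. \<exists>A\<in>conj_family K F. A \<subseteq> N (Suc (to_nat q))"
    using inK N(1,2) by blast
  then obtain S where S: "\<And>q::rat. S q \<in> conj_family K F \<and> S q \<subseteq> N (Suc (to_nat q))" by metis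
  have "ordered_product K S qs \<subseteq> V" if "sorted_wrt (<) qs" for qs
    unfolding N0[symmetric]
  proof (rule ordered_product_bound[where i = to_nat])
    show "N n \<subseteq> carrier K" for n using openin_subset[OF N(1)] top by blast
    show "distinct qs" using that by (simp add: strict_sorted_iff)
  qed (use N S in auto)
  then have "U' K S \<subseteq> V" unfolding U'_eq by blast
  then have "\<forall>u\<in>U' K S. z \<otimes> u \<in> W" using zc top by (auto simp: V_def)
  with S show "\<exists>S. conj_tuple S \<and> (\<forall>u\<in>U' K S. z \<otimes> u \<in> W)" by (auto simp: conj_tuple_def)
qed

end

section \<open>The topology on a semidirect product\<close>

lemma continuous_map_pullback_topology_iff:
  "continuous_map X (pullback_topology A f T) g \<longleftrightarrow>
     continuous_map X T (f \<circ> g) \<and> g ` topspace X \<subseteq> A"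
proof (intro iffI conjI)
  assume g: "continuous_map X (pullback_topology A f T) g"
  have "continuous_map (pullback_topology A f T) T (id \<circ> f)"
    by (intro continuous_map_pullback continuous_map_id)
  with g show "continuous_map X T (f \<circ> g)"
    using continuous_map_compose by fastforce
  show "g ` topspace X \<subseteq> A"
    using continuous_map_image_subset_topspace[OF g] by (auto simp: topspace_pullback_topology)
qed (auto intro: continuous_map_pullback')

text \<open>That the semidirect product is a group and that \<open>\<alpha>\<close> preserves the carrier of \<open>H\<close> says that \<open>G\<close>
  acts on \<open>H\<close> by automorphisms.\<close>

locale topological_semidirect =
  H: group H + G: group G + K: group "semidirect H G \<alpha>"
  for H :: "('h, 'm) monoid_scheme" and G :: "('g, 'n) monoid_scheme"
    and \<alpha> :: "'g \<Rightarrow> 'h \<Rightarrow> 'h" +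
  fixes \<sigma> :: "'g topology"
  assumes group_topology: "group_topology G \<sigma>"
    and action_closed: "g \<in> carrier G \<Longrightarrow> h \<in> carrier H \<Longrightarrow> \<alpha> g h \<in> carrier H"
begin

abbreviation "K \<equiv> semidirect H G \<alpha>"
abbreviation "\<rho> \<equiv> prod_topology (discrete_topology (carrier H)) \<sigma>"
abbreviation "T' \<equiv> sharp_topology K \<rho>"
abbreviation "T'\<^sub>H \<equiv> T'_topology H G \<sigma> \<alpha>"

lemma carrier_K: "carrier K = carrier H \<times> carrier G"
  and one_K: "\<one>\<^bsub>K\<^esub> = (\<one>\<^bsub>H\<^esub>, \<one>\<^bsub>G\<^esub>)"
  and mult_K: "(h, g) \<otimes>\<^bsub>K\<^esub> (h', g') = (h \<otimes>\<^bsub>H\<^esub> \<alpha> g h', g \<otimes>\<^bsub>G\<^esub> g')"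
  by (simp_all add: semidirect_def)

lemma topspace_\<sigma>: "topspace \<sigma> = carrier G"
  using group_topology by (simp add: group_topology_def)


lemma action_one: "h \<in> carrier H \<Longrightarrow> \<alpha> \<one>\<^bsub>G\<^esub> h = h"
  using K.l_one[of "(h, \<one>\<^bsub>G\<^esub>)"] action_closed[of "\<one>\<^bsub>G\<^esub>" h]
  by (simp add: carrier_K one_K mult_K)

lemma action_unit: "g \<in> carrier G \<Longrightarrow> \<alpha> g \<one>\<^bsub>H\<^esub> = \<one>\<^bsub>H\<^esub>"
  using K.r_one[of "(\<one>\<^bsub>H\<^esub>, g)"] action_closed[of g "\<one>\<^bsub>H\<^esub>"]
  by (simp add: carrier_K one_K mult_K)

lemma continuous_times_G:
  assumes "continuous_map X \<sigma> f" "continuous_map X \<sigma> g"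
  shows "continuous_map X \<sigma> (\<lambda>x. f x \<otimes>\<^bsub>G\<^esub> g x)"
  using semigroup_topology_times[of G \<sigma>] assms group_topology
  by (simp add: group_topology_def semigroup_topology_def)

lemma nbhd_base: "group_filter_base K {V. openin \<rho> V \<and> \<one>\<^bsub>K\<^esub> \<in> V}"
proof
  have "openin \<rho> (topspace \<rho>)" by (rule openin_topspace)
  moreover have "\<one>\<^bsub>K\<^esub> \<in> topspace \<rho>" by (simp add: one_K topspace_\<sigma>)
  ultimately show "{V. openin \<rho> V \<and> \<one>\<^bsub>K\<^esub> \<in> V} \<noteq> {}" by blast
  show "A \<subseteq> carrier K" if "A \<in> {V. openin \<rho> V \<and> \<one>\<^bsub>K\<^esub> \<in> V}" for A
    using that openin_subset[of \<rho> A] by (simp add: carrier_K topspace_\<sigma>)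
  show "\<exists>C\<in>{V. openin \<rho> V \<and> \<one>\<^bsub>K\<^esub> \<in> V}. C \<subseteq> A \<inter> B"
    if "A \<in> {V. openin \<rho> V \<and> \<one>\<^bsub>K\<^esub> \<in> V}" "B \<in> {V. openin \<rho> V \<and> \<one>\<^bsub>K\<^esub> \<in> V}" for A B
    using that by (intro bexI[of _ "A \<inter> B"]) auto
qed

lemma semigroup_topology_T': "semigroup_topology K T'"
  unfolding sharp_topology_def by (rule group_filter_base.semigroup_topology_T'_fam[OF nbhd_base])

lemma topspace_T': "topspace T' = carrier H \<times> carrier G"
  using semigroup_topology_T' by (simp add: semigroup_topology_def carrier_K)

text \<open>Continuity at the neutral element holds because the neighbourhoods for \<open>D \<times> \<sigma>\<close> converge to it;
  a homomorphism that is continuous there is continuous everywhere, since translations of \<open>\<sigma>\<close> are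
  continuous.\<close>

lemma continuous_G_in_T': "continuous_map \<sigma> T' (\<lambda>g. (\<one>\<^bsub>H\<^esub>, g))"
  unfolding continuous_map_def
proof (intro conjI allI impI)
  show "(\<lambda>g. (\<one>\<^bsub>H\<^esub>, g)) \<in> topspace \<sigma> \<rightarrow> topspace T'"
    by (simp add: topspace_\<sigma> topspace_T')
  fix W assume W: "openin T' W"
  show "openin \<sigma> {g \<in> topspace \<sigma>. (\<one>\<^bsub>H\<^esub>, g) \<in> W}"
  proof (subst openin_subopen, intro ballI)
    fix g assume "g \<in> {g \<in> topspace \<sigma>. (\<one>\<^bsub>H\<^esub>, g) \<in> W}"
    then have g: "g \<in> carrier G" "(\<one>\<^bsub>H\<^esub>, g) \<in> W" by (simp_all add: topspace_\<sigma>)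
    obtain V where V: "openin \<rho> V" "\<one>\<^bsub>K\<^esub> \<in> V" "\<forall>v\<in>V. (\<one>\<^bsub>H\<^esub>, g) \<otimes>\<^bsub>K\<^esub> v \<in> W"
      using group_filter_base.T'_fam_converges[OF nbhd_base W[unfolded sharp_topology_def] g(2)] by blast
    \<comment> \<open>The neighbourhood of \<open>g\<close> is the left translate by \<open>g\<close> of the trace of \<open>V\<close> on \<open>G\<close>.\<close>
    have "continuous_map \<sigma> \<sigma> (\<lambda>k. inv\<^bsub>G\<^esub> g \<otimes>\<^bsub>G\<^esub> k)"
      using g(1) by (intro continuous_times_G) (simp_all add: topspace_\<sigma>)
    then have "continuous_map \<sigma> \<rho> (\<lambda>k. (\<one>\<^bsub>H\<^esub>, inv\<^bsub>G\<^esub> g \<otimes>\<^bsub>G\<^esub> k))"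
      by (intro continuous_map_pairedI) simp_all
    then have "openin \<sigma> {k \<in> topspace \<sigma>. (\<one>\<^bsub>H\<^esub>, inv\<^bsub>G\<^esub> g \<otimes>\<^bsub>G\<^esub> k) \<in> V}" (is "openin \<sigma> ?N")
      using V(1) by (rule openin_continuous_map_preimage)
    moreover have "g \<in> ?N"
      using V(2) g(1) by (simp add: topspace_\<sigma> one_K)
    moreover have "?N \<subseteq> {g \<in> topspace \<sigma>. (\<one>\<^bsub>H\<^esub>, g) \<in> W}"
    proof clarify
      fix k assume k: "k \<in> topspace \<sigma>" "(\<one>\<^bsub>H\<^esub>, inv\<^bsub>G\<^esub> g \<otimes>\<^bsub>G\<^esub> k) \<in> V"
      then have "(\<one>\<^bsub>H\<^esub>, g) \<otimes>\<^bsub>K\<^esub> (\<one>\<^bsub>H\<^esub>, inv\<^bsub>G\<^esub> g \<otimes>\<^bsub>G\<^esub> k) \<in> W" using V(3) by blast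
      then show "(\<one>\<^bsub>H\<^esub>, k) \<in> W"
        using g(1) k(1) by (simp add: mult_K action_unit topspace_\<sigma> G.m_assoc[symmetric])
    qed
    ultimately show "\<exists>N. openin \<sigma> N \<and> g \<in> N \<and> N \<subseteq> {g \<in> topspace \<sigma>. (\<one>\<^bsub>H\<^esub>, g) \<in> W}" by blast
  qed
qed

text \<open>A neighbourhood of the neutral element for \<open>D \<times> \<sigma>\<close> may be shrunk to \<open>{1} \<times> A\<close> as \<open>D\<close> is discrete, so
  convergence of these neighbourhoods in \<open>\<tau>\<close> is a condition on \<open>G\<close> alone.\<close>

lemma T'_finest:
  assumes \<tau>: "semigroup_topology K \<tau>"
    and cont: "continuous_map \<sigma> \<tau> (\<lambda>g. (\<one>\<^bsub>H\<^esub>, g))"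
    and W: "openin \<tau> W"
  shows "openin T' W"
  unfolding sharp_topology_def
proof (rule group_filter_base.T'_fam_finest[OF nbhd_base \<tau> _ W])
  fix V assume V: "openin \<tau> V" "\<one>\<^bsub>K\<^esub> \<in> V"
  let ?A = "{\<one>\<^bsub>H\<^esub>} \<times> {g \<in> topspace \<sigma>. (\<one>\<^bsub>H\<^esub>, g) \<in> V}"
  have "openin \<rho> ?A"
    using openin_continuous_map_preimage[OF cont V(1)] by (simp add: openin_prod_Times_iff)
  then show "\<exists>A\<in>{V. openin \<rho> V \<and> \<one>\<^bsub>K\<^esub> \<in> V}. A \<subseteq> V"
    using V(2) by (intro bexI[of _ ?A]) (auto simp: one_K topspace_\<sigma>)
qed

lemma topspace_T'\<^sub>H: "topspace T'\<^sub>H = carrier H"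
  by (auto simp: T'_topology_def topspace_pullback_topology topspace_T')

lemma continuous_into_T'\<^sub>H:
  "continuous_map X T'\<^sub>H f \<longleftrightarrow>
     continuous_map X T' (\<lambda>x. (f x, \<one>\<^bsub>G\<^esub>)) \<and> f ` topspace X \<subseteq> carrier H"
  by (simp add: T'_topology_def continuous_map_pullback_topology_iff o_def)

lemma continuous_from_T'\<^sub>H: "continuous_map T'\<^sub>H T' (\<lambda>h. (h, \<one>\<^bsub>G\<^esub>))"
  using continuous_into_T'\<^sub>H[of T'\<^sub>H "\<lambda>h. h"] by simp

lemma semigroup_topology_T'\<^sub>H: "semigroup_topology H T'\<^sub>H"
  unfolding semigroup_topology_def
proof (intro conjI topspace_T'\<^sub>H)
  have "continuous_map (prod_topology T'\<^sub>H T'\<^sub>H) T' (\<lambda>p. (fst p, \<one>\<^bsub>G\<^esub>) \<otimes>\<^bsub>K\<^esub> (snd p, \<one>\<^bsub>G\<^esub>))"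
    using continuous_map_compose[OF continuous_map_fst continuous_from_T'\<^sub>H]
      continuous_map_compose[OF continuous_map_snd continuous_from_T'\<^sub>H]
    by (intro semigroup_topology_times[OF semigroup_topology_T']) (simp_all add: o_def)
  then have "continuous_map (prod_topology T'\<^sub>H T'\<^sub>H) T' (\<lambda>p. (fst p \<otimes>\<^bsub>H\<^esub> snd p, \<one>\<^bsub>G\<^esub>))"
    by (rule continuous_map_eq) (auto simp: topspace_T'\<^sub>H mult_K action_one)
  then show "continuous_map (prod_topology T'\<^sub>H T'\<^sub>H) T'\<^sub>H (\<lambda>(x, y). x \<otimes>\<^bsub>H\<^esub> y)"
    by (auto simp: continuous_into_T'\<^sub>H case_prod_unfold topspace_T'\<^sub>H)
qed

text \<open>In the semidirect product the action is conjugation: \<open>(g(h), 1) = (1, g) (h, 1) (1, g\<^sup>-\<^sup>1)\<close>.\<close>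

lemma continuous_action_T'\<^sub>H: "continuous_action \<sigma> T'\<^sub>H \<alpha>"
proof -
  let ?X = "prod_topology \<sigma> T'\<^sub>H"
  have "continuous_map \<sigma> \<sigma> (\<lambda>g. inv\<^bsub>G\<^esub> g)"
    using group_topology by (simp add: group_topology_def)
  then have inv: "continuous_map \<sigma> T' (\<lambda>g. (\<one>\<^bsub>H\<^esub>, inv\<^bsub>G\<^esub> g))"
    using continuous_map_compose[OF _ continuous_G_in_T'] by (fastforce simp: o_def)
  have "continuous_map ?X T'
      (\<lambda>p. (\<one>\<^bsub>H\<^esub>, fst p) \<otimes>\<^bsub>K\<^esub> ((snd p, \<one>\<^bsub>G\<^esub>) \<otimes>\<^bsub>K\<^esub> (\<one>\<^bsub>H\<^esub>, inv\<^bsub>G\<^esub> (fst p))))"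
    using continuous_map_compose[OF continuous_map_fst continuous_G_in_T']
      continuous_map_compose[OF continuous_map_fst inv]
      continuous_map_compose[OF continuous_map_snd continuous_from_T'\<^sub>H]
    by (intro semigroup_topology_times[OF semigroup_topology_T']) (simp_all add: o_def)
  then have "continuous_map ?X T' (\<lambda>p. (\<alpha> (fst p) (snd p), \<one>\<^bsub>G\<^esub>))"
    by (rule continuous_map_eq)
      (auto simp: topspace_T'\<^sub>H topspace_\<sigma> mult_K action_one action_closed)
  then show ?thesis
    by (auto simp: continuous_action_def continuous_into_T'\<^sub>H case_prod_unfold topspace_T'\<^sub>H
        topspace_\<sigma> action_closed)
qed

end

section \<open>The ring operations as products of matrices\<close>

definition swap12 :: "'a::ring_1 ^ 3 ^ 3" where
  "swap12 = vector [vector [0, 1, 0], vector [1, 0, 0], vector [0, 0, 1]]"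

definition swap23 :: "'a::ring_1 ^ 3 ^ 3" where
  "swap23 = vector [vector [1, 0, 0], vector [0, 0, 1], vector [0, 1, 0]]"

definition flip1 :: "'a::ring_1 ^ 3 ^ 3" where
  "flip1 = vector [vector [-1, 0, 0], vector [0, 1, 0], vector [0, 0, 1]]"

lemmas matrix3_simps = vec_eq_iff forall_3 matrix_matrix_mult_def sum_3 mat_def

lemma involution_invertible: "A ** A = mat 1 \<Longrightarrow> invertible A"
  for A :: "'a::ring_1 ^ 3 ^ 3"
  by (auto simp: invertible_def)

lemma invertible_swap12: "invertible swap12"
  and invertible_swap23: "invertible swap23"
  and invertible_flip1: "invertible flip1"
  by (rule involution_invertible, simp add: matrix3_simps swap12_def swap23_def flip1_def)+

lemma Unitization_add: "Unitization (x + y) 0 = Unitization x 0 + Unitization y 0"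
  and Unitization_minus: "Unitization (- x) 0 = - Unitization x 0"
  and Unitization_times: "Unitization (x * y) 0 = Unitization x 0 * Unitization y 0"
  by (simp_all add: plus_unitization_def uminus_unitization_def times_unitization_def)

lemma ring_embedding_add: "ring_embedding (x + y) = ring_embedding x ** ring_embedding y"
  by (simp add: matrix3_simps ring_embedding_def Unitization_add add.commute)

lemma ring_embedding_0: "ring_embedding 0 = mat 1"
  by (simp add: matrix3_simps ring_embedding_def zero_unitization_def)

lemma invertible_ring_embedding: "invertible (ring_embedding x)"
  unfolding invertible_def
  using ring_embedding_add[of x "- x"] ring_embedding_add[of "- x" x]
  by (auto simp: ring_embedding_0 intro!: exI[of _ "ring_embedding (- x)"])

lemma ring_embedding_corner: "ring_embedding x $ 1 $ 3 = Unitization x 0"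
  by (simp add: ring_embedding_def)

lemma ring_embedding_minus: "ring_embedding (- x) = flip1 ** (ring_embedding x ** flip1)"
  by (simp add: matrix3_simps ring_embedding_def flip1_def Unitization_minus)

text \<open>The four factors are \<open>E\<^sub>1\<^sub>2(x)\<close>, \<open>E\<^sub>2\<^sub>3(y)\<close>, \<open>E\<^sub>1\<^sub>2(-x)\<close> and \<open>E\<^sub>2\<^sub>3(-y)\<close>, written as conjugates of
  elements of the embedded ring so that continuity of matrix multiplication applies to them.\<close>

lemma ring_embedding_times:
  "ring_embedding (x * y) =
     (swap23 ** (ring_embedding x ** swap23)) ** ((swap12 ** (ring_embedding y ** swap12)) **
     ((swap23 ** (ring_embedding (- x) ** swap23)) ** (swap12 ** (ring_embedding (- y) ** swap12))))"
  by (simp add: matrix3_simps ring_embedding_def swap12_def swap23_def Unitization_minus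
      Unitization_times)

lemma ring_topologyI:
  fixes \<tau> :: "'r::ring topology"
  assumes "topspace \<tau> = UNIV"
    and "continuous_map (prod_topology \<tau> \<tau>) \<tau> (\<lambda>p. fst p + snd p)"
    and "continuous_map \<tau> \<tau> (\<lambda>x. - x)"
    and "continuous_map (prod_topology \<tau> \<tau>) \<tau> (\<lambda>p. fst p * snd p)"
  shows "ring_topology \<tau>"
  using assms by (simp add: ring_topology_def case_prod_unfold)

lemma ring_topology_continuous:
  fixes \<tau> :: "'r::ring topology"
  assumes \<tau>: "ring_topology \<tau>" and f: "continuous_map X \<tau> f" and g: "continuous_map X \<tau> g"
  shows "continuous_map X \<tau> (\<lambda>x. f x + g x)" "continuous_map X \<tau> (\<lambda>x. - f x)"
    "continuous_map X \<tau> (\<lambda>x. f x - g x)" "continuous_map X \<tau> (\<lambda>x. f x * g x)"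
proof -
  have add: "continuous_map X \<tau> (\<lambda>x. u x + v x)" "continuous_map X \<tau> (\<lambda>x. - v x)"
    "continuous_map X \<tau> (\<lambda>x. u x * v x)"
    if u: "continuous_map X \<tau> u" and v: "continuous_map X \<tau> v" for u v
    using \<tau> continuous_map_compose[OF continuous_map_pairedI[OF u v], of \<tau> "\<lambda>(x, y). x + y"]
      continuous_map_compose[OF continuous_map_pairedI[OF u v], of \<tau> "\<lambda>(x, y). x * y"]
      continuous_map_compose[OF v, of \<tau> uminus]
    by (simp_all add: ring_topology_def o_def)
  show "continuous_map X \<tau> (\<lambda>x. f x + g x)" "continuous_map X \<tau> (\<lambda>x. - f x)"
    "continuous_map X \<tau> (\<lambda>x. f x * g x)" using add f g by blast+
  show "continuous_map X \<tau> (\<lambda>x. f x - g x)"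
    using add(1)[OF f add(2)[OF g g]] by simp
qed

context
  fixes G :: "('g, 'm) monoid_scheme" and \<sigma> :: "'g topology" and \<alpha> :: "'g \<Rightarrow> 'r::ring \<Rightarrow> 'r"
  assumes G: "group G" and \<sigma>: "group_topology G \<sigma>" and \<alpha>: "ring_automorphism_action G \<alpha>"
begin

abbreviation "entrywise g \<equiv> map_matrix (unitization_action \<alpha> g)"

lemma topological_semidirect_GL3: "topological_semidirect GL3 G entrywise \<sigma>"
proof -
  interpret K: group "semidirect GL3 G entrywise"
    using G \<alpha> by (rule group_semidirect_GL3)
  \<comment> \<open>The product of \<open>(1, g)\<close> and \<open>(A, 1)\<close> in the group \<open>K\<close> is \<open>(g(A), g)\<close>.\<close>
  have "entrywise g A \<in> carrier GL3" if "g \<in> carrier G" "A \<in> carrier GL3" for g A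
    using K.m_closed[of "(mat 1, g)" "(A, \<one>\<^bsub>G\<^esub>)"] K.one_closed that
    by (simp add: semidirect_def GL3_def)
  then show ?thesis
    using G \<sigma> group_GL3 K.group_axioms
    by (simp add: topological_semidirect_def topological_semidirect_axioms_def)
qed

interpretation topological_semidirect GL3 G entrywise \<sigma>
  by (rule topological_semidirect_GL3)

abbreviation (input) "Tr \<equiv> Tr_topology G \<sigma> \<alpha>"

lemma continuous_into_Tr:
  "continuous_map X Tr f \<longleftrightarrow> continuous_map X T'\<^sub>H (\<lambda>x. ring_embedding (f x))"
  by (simp add: Tr_topology_def continuous_map_pullback_topology_iff o_def)

lemma topspace_Tr: "topspace Tr = UNIV"
  unfolding Tr_topology_def topspace_pullback_topology topspace_T'\<^sub>H
  by (auto simp: GL3_def invertible_ring_embedding)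

lemma continuous_matrix_mult:
  assumes "continuous_map X T'\<^sub>H A" "continuous_map X T'\<^sub>H B"
  shows "continuous_map X T'\<^sub>H (\<lambda>x. A x ** B x)"
  using semigroup_topology_times[OF semigroup_topology_T'\<^sub>H assms] by (simp add: GL3_def)

lemma continuous_const_matrix: "invertible A \<Longrightarrow> continuous_map X T'\<^sub>H (\<lambda>_. A)"
  using topspace_T'\<^sub>H by (simp add: GL3_def)

lemmas continuous_matrix_intros = continuous_matrix_mult continuous_const_matrix
  invertible_swap12 invertible_swap23 invertible_flip1

text \<open>Every operation has been written as a product of embedded elements and constant matrices.\<close>

lemma ring_topology_Tr: "ring_topology Tr"
proof (rule ring_topologyI[OF topspace_Tr])
  have fst: "continuous_map (prod_topology Tr Tr) Tr fst"
    and snd: "continuous_map (prod_topology Tr Tr) Tr snd"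
    by (rule continuous_map_fst continuous_map_snd)+
  have minus: "continuous_map X Tr (\<lambda>x. - f x)" if "continuous_map X Tr f" for X :: "'x topology" and f
    unfolding continuous_into_Tr ring_embedding_minus using that[unfolded continuous_into_Tr]
    by (intro continuous_matrix_intros)
  from minus[OF continuous_map_id[unfolded id_def]] show "continuous_map Tr Tr (\<lambda>x. - x)" .
  show "continuous_map (prod_topology Tr Tr) Tr (\<lambda>p. fst p + snd p)"
    unfolding continuous_into_Tr ring_embedding_add using fst snd
    by (intro continuous_matrix_intros) (simp_all add: continuous_into_Tr)
  show "continuous_map (prod_topology Tr Tr) Tr (\<lambda>p. fst p * snd p)"
    unfolding continuous_into_Tr ring_embedding_times
    using fst snd minus[OF fst] minus[OF snd]
    by (intro continuous_matrix_intros) (simp_all add: continuous_into_Tr)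
qed

lemma action_zero: "g \<in> carrier G \<Longrightarrow> \<alpha> g 0 = 0"
  using \<alpha> by (metis add_cancel_right_right ring_automorphism_action_def)

lemma ring_embedding_action:
  "g \<in> carrier G \<Longrightarrow> ring_embedding (\<alpha> g x) = entrywise g (ring_embedding x)"
  by (simp add: vec_eq_iff forall_3 ring_embedding_def unitization_action_def action_zero
      zero_unitization_def one_unitization_def)

lemma continuous_action_Tr: "continuous_action \<sigma> Tr \<alpha>"
proof -
  let ?X = "prod_topology \<sigma> Tr"
  have "continuous_map ?X T'\<^sub>H (\<lambda>p. ring_embedding (snd p))"
    using continuous_map_snd[of \<sigma> Tr] unfolding continuous_into_Tr .
  then have "continuous_map ?X T'\<^sub>H (\<lambda>p. entrywise (fst p) (ring_embedding (snd p)))"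
    using continuous_map_compose[OF continuous_map_pairedI, OF continuous_map_fst]
      continuous_action_T'\<^sub>H
    by (fastforce simp: continuous_action_def o_def)
  then have "continuous_map ?X T'\<^sub>H (\<lambda>p. ring_embedding (\<alpha> (fst p) (snd p)))"
    by (rule continuous_map_eq) (auto simp: ring_embedding_action topspace_\<sigma>)
  then show ?thesis by (simp add: continuous_action_def continuous_into_Tr case_prod_unfold)
qed

end

section \<open>Extending a ring topology to the semidirect product\<close>

definition unitization_topology :: "'r topology \<Rightarrow> 'r unitization topology" where
  "unitization_topology \<tau> = pullback_topology UNIV (\<lambda>u. (ring_part u, int_part u))
     (prod_topology \<tau> (discrete_topology UNIV))"

lemma continuous_into_unitization:
  "continuous_map X (unitization_topology \<tau>) f \<longleftrightarrow>
     continuous_map X \<tau> (\<lambda>x. ring_part (f x)) \<and>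
     continuous_map X (discrete_topology UNIV) (\<lambda>x. int_part (f x))"
  by (simp add: unitization_topology_def continuous_map_pullback_topology_iff o_def
      continuous_map_pairwise)

text \<open>The multiplier is locally constant, and multiplication by a fixed integer is an iterated sum.\<close>

lemma continuous_int_multiple:
  fixes \<tau> :: "'r::ring topology"
  assumes \<tau>: "ring_topology \<tau>"
    and k: "continuous_map X (discrete_topology UNIV) k" and a: "continuous_map X \<tau> a"
  shows "continuous_map X \<tau> (\<lambda>x. int_multiple (k x) (a x))"
proof (rule pasting_lemma[where I = UNIV and T = "\<lambda>l. {x \<in> topspace X. k x = l}"
      and f = "\<lambda>l x. int_multiple l (a x)"])
  fix l
  show "openin X {x \<in> topspace X. k x = l}"
    using openin_continuous_map_preimage[OF k, of "{l}"] by simp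
  have "continuous_map X \<tau> (\<lambda>x. int_multiple l (a x))"
  proof (induction l rule: int_induct[where k = 0])
    case base
    then show ?case using \<tau> by (simp add: ring_topology_def)
  next
    case (step1 l)
    then show ?case
      unfolding int_multiple_add1 using ring_topology_continuous(1)[OF \<tau> _ a] by blast
  next
    case (step2 l)
    then show ?case
      unfolding int_multiple_diff1 using ring_topology_continuous(3)[OF \<tau> _ a] by blast
  qed
  then show "continuous_map (subtopology X {x \<in> topspace X. k x = l}) \<tau> (\<lambda>x. int_multiple l (a x))"
    by (rule continuous_map_from_subtopology)
qed auto

lemma continuous_discrete_binary:
  assumes "continuous_map X (discrete_topology UNIV) k" "continuous_map X (discrete_topology UNIV) l"
  shows "continuous_map X (discrete_topology UNIV) (\<lambda>x. f (k x) (l x))"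
  using continuous_map_compose[OF continuous_map_pairedI[OF assms],
      of "discrete_topology UNIV" "\<lambda>(a, b). f a b"]
  by (simp add: o_def flip: prod_topology_discrete_topology)

lemma continuous_unitization_add:
  fixes \<tau> :: "'r::ring topology"
  assumes "ring_topology \<tau>" "continuous_map X (unitization_topology \<tau>) f"
    "continuous_map X (unitization_topology \<tau>) g"
  shows "continuous_map X (unitization_topology \<tau>) (\<lambda>x. f x + g x)"
  using assms
  by (simp add: continuous_into_unitization plus_unitization_def ring_topology_continuous
      continuous_discrete_binary[of _ _ _ "(+)"])

lemma continuous_unitization_times:
  fixes \<tau> :: "'r::ring topology"
  assumes "ring_topology \<tau>" "continuous_map X (unitization_topology \<tau>) f"
    "continuous_map X (unitization_topology \<tau>) g"
  shows "continuous_map X (unitization_topology \<tau>) (\<lambda>x. f x * g x)"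
  using assms
  by (simp add: continuous_into_unitization times_unitization_def ring_topology_continuous
      continuous_discrete_binary[of _ _ _ "(*)"] continuous_int_multiple)

definition GL3_topology :: "'a::ring_1 topology \<Rightarrow> ('a ^ 3 ^ 3) topology" where
  "GL3_topology \<tau> = pullback_topology (carrier GL3) (\<lambda>A (i, j). A $ i $ j) (product_topology (\<lambda>_. \<tau>) UNIV)"

lemma continuous_into_GL3:
  "continuous_map X (GL3_topology \<tau>) A \<longleftrightarrow>
     (\<forall>i j. continuous_map X \<tau> (\<lambda>x. A x $ i $ j)) \<and> A ` topspace X \<subseteq> carrier GL3"
  by (simp add: GL3_topology_def continuous_map_pullback_topology_iff o_def
      continuous_map_componentwise_UNIV case_prod_unfold)

lemma topspace_GL3_topology: "topspace \<tau> = UNIV \<Longrightarrow> topspace (GL3_topology \<tau>) = carrier GL3"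
  by (simp add: GL3_topology_def topspace_pullback_topology)

lemma continuous_entry: "continuous_map (GL3_topology \<tau>) \<tau> (\<lambda>A. A $ i $ j)"
  using continuous_map_id[of "GL3_topology \<tau>"] unfolding id_def continuous_into_GL3 by blast

context
  fixes G :: "('g, 'm) monoid_scheme" and \<sigma> :: "'g topology" and \<alpha> :: "'g \<Rightarrow> 'r::ring \<Rightarrow> 'r"
    and \<tau> :: "'r topology"
  assumes G: "group G" and \<sigma>: "group_topology G \<sigma>" and \<alpha>: "ring_automorphism_action G \<alpha>"
    and \<tau>: "ring_topology \<tau>" and act: "continuous_action \<sigma> \<tau> \<alpha>"
begin

interpretation topological_semidirect GL3 G "entrywise \<alpha>" \<sigma>
  using G \<sigma> \<alpha> by (rule topological_semidirect_GL3)

abbreviation "\<tau>\<^sub>1 \<equiv> unitization_topology \<tau>"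
abbreviation "\<tau>\<^sub>K \<equiv> prod_topology (GL3_topology \<tau>\<^sub>1) \<sigma>"

lemma topspace_\<tau>\<^sub>1: "topspace \<tau>\<^sub>1 = UNIV"
  using \<tau> by (simp add: unitization_topology_def topspace_pullback_topology ring_topology_def)

lemma continuous_unitization_action:
  assumes "continuous_map X \<sigma> g" "continuous_map X \<tau>\<^sub>1 u"
  shows "continuous_map X \<tau>\<^sub>1 (\<lambda>x. unitization_action \<alpha> (g x) (u x))"
  using assms act continuous_map_compose[OF continuous_map_pairedI[OF assms(1)],
      of \<tau> "\<lambda>x. ring_part (u x)" \<tau> "\<lambda>(g, x). \<alpha> g x"]
  by (simp add: continuous_into_unitization unitization_action_def continuous_action_def o_def)

text \<open>The entries of \<open>A \<cdot> g(B)\<close> are sums of products of entries of \<open>A\<close> and of images under \<open>g\<close> of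
  entries of \<open>B\<close>.\<close>

lemma semigroup_topology_\<tau>\<^sub>K: "semigroup_topology (semidirect GL3 G (entrywise \<alpha>)) \<tau>\<^sub>K"
  unfolding semigroup_topology_def
proof
  show top: "topspace \<tau>\<^sub>K = carrier K"
    by (simp add: topspace_GL3_topology topspace_\<tau>\<^sub>1 topspace_\<sigma> carrier_K)
  let ?X = "prod_topology \<tau>\<^sub>K \<tau>\<^sub>K"
  let ?A = "\<lambda>p. fst (fst p)" and ?g = "\<lambda>p. snd (fst p)"
    and ?B = "\<lambda>p. fst (snd p)" and ?h = "\<lambda>p. snd (snd p)"
  have A: "continuous_map ?X (GL3_topology \<tau>\<^sub>1) ?A" and g: "continuous_map ?X \<sigma> ?g"
    and B: "continuous_map ?X (GL3_topology \<tau>\<^sub>1) ?B" and h: "continuous_map ?X \<sigma> ?h"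
    by (intro continuous_map_fst_of continuous_map_snd_of continuous_map_fst continuous_map_snd
        continuous_map_compose[unfolded o_def, of _ \<tau>\<^sub>K])+
  have closed: "?A p ** entrywise \<alpha> (?g p) (?B p) \<in> carrier GL3" if "p \<in> topspace ?X" for p
  proof -
    have "?A p \<in> carrier GL3" "?g p \<in> carrier G" "?B p \<in> carrier GL3"
      using that by (auto simp: topspace_GL3_topology topspace_\<tau>\<^sub>1 topspace_\<sigma>)
    from H.m_closed[OF this(1) action_closed[OF this(2,3)]] show ?thesis
      by (simp add: GL3_def)
  qed
  have entry: "continuous_map ?X \<tau>\<^sub>1 (\<lambda>p. (?A p ** entrywise \<alpha> (?g p) (?B p)) $ i $ j)" for i j
    unfolding matrix_matrix_mult_def using A B g
    by (simp add: sum_3 continuous_into_GL3 continuous_unitization_add[OF \<tau>]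
        continuous_unitization_times[OF \<tau>] continuous_unitization_action)
  have "continuous_map ?X \<tau>\<^sub>K (\<lambda>p. (?A p ** entrywise \<alpha> (?g p) (?B p), ?g p \<otimes>\<^bsub>G\<^esub> ?h p))"
  proof (rule continuous_map_pairedI)
    show "continuous_map ?X (GL3_topology \<tau>\<^sub>1) (\<lambda>p. ?A p ** entrywise \<alpha> (?g p) (?B p))"
      unfolding continuous_into_GL3 using entry closed by blast
    show "continuous_map ?X \<sigma> (\<lambda>p. ?g p \<otimes>\<^bsub>G\<^esub> ?h p)"
      using g h by (rule continuous_times_G)
  qed
  then show "continuous_map ?X \<tau>\<^sub>K (\<lambda>(x, y). x \<otimes>\<^bsub>K\<^esub> y)"
    by (simp add: semidirect_def GL3_def case_prod_unfold)
qed

text \<open>The set \<open>W\<close> below consists of the elements of \<open>K\<close> whose matrix has the ring part of its upper right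
  entry in \<open>U\<close>; its trace on the embedded copy of \<open>R\<close> is \<open>U\<close>.\<close>

lemma Tr_finest:
  assumes U: "openin \<tau> U" shows "openin (Tr_topology G \<sigma> \<alpha>) U"
proof -
  let ?f = "\<lambda>p. ring_part (fst p $ 1 $ 3)"
  define W where "W = {p \<in> topspace \<tau>\<^sub>K. ?f p \<in> U}"
  have "continuous_map \<tau>\<^sub>K \<tau>\<^sub>1 (\<lambda>p. fst p $ 1 $ 3)"
    using continuous_map_compose[OF continuous_map_fst continuous_entry] by (simp add: o_def)
  then have "openin \<tau>\<^sub>K W"
    unfolding W_def using U by (intro openin_continuous_map_preimage)
      (auto simp: continuous_into_unitization)
  moreover have "continuous_map \<sigma> \<tau>\<^sub>K (\<lambda>g. (\<one>\<^bsub>GL3\<^esub>, g))"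
    using group.is_monoid[OF group_GL3] monoid.one_closed
    by (intro continuous_map_pairedI) (auto simp: topspace_GL3_topology topspace_\<tau>\<^sub>1)
  ultimately have "openin T' W"
    by (intro T'_finest[OF semigroup_topology_\<tau>\<^sub>K])
  moreover have "continuous_map (Tr_topology G \<sigma> \<alpha>) T' (\<lambda>x. (ring_embedding x, \<one>\<^bsub>G\<^esub>))"
    using continuous_into_Tr[OF G \<sigma> \<alpha>, of "Tr_topology G \<sigma> \<alpha>" "\<lambda>x. x"]
    by (simp add: continuous_into_T'\<^sub>H)
  ultimately have "openin (Tr_topology G \<sigma> \<alpha>)
      {x \<in> topspace (Tr_topology G \<sigma> \<alpha>). (ring_embedding x, \<one>\<^bsub>G\<^esub>) \<in> W}"
    by (intro openin_continuous_map_preimage)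
  moreover have "(ring_embedding x, \<one>\<^bsub>G\<^esub>) \<in> W \<longleftrightarrow> x \<in> U" for x
    by (simp add: W_def topspace_GL3_topology topspace_\<tau>\<^sub>1 topspace_\<sigma> GL3_def
        invertible_ring_embedding ring_embedding_corner)
  ultimately show ?thesis by (simp add: topspace_Tr[OF G \<sigma> \<alpha>])
qed

end

theorem theorem2p9:
  fixes G :: "('g, 'm) monoid_scheme"
    and \<sigma> :: "'g topology"
    and \<alpha> :: "'g \<Rightarrow> 'r::ring \<Rightarrow> 'r"
  assumes "group G"
    and "group_topology G \<sigma>"
    and "ring_automorphism_action G \<alpha>"
  shows "ring_topology (Tr_topology G \<sigma> \<alpha>) \<and>
    continuous_action \<sigma> (Tr_topology G \<sigma> \<alpha>) \<alpha> \<and>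
    (\<forall>\<tau>. ring_topology \<tau> \<and> continuous_action \<sigma> \<tau> \<alpha> \<longrightarrow>
       (\<forall>U. openin \<tau> U \<longrightarrow> openin (Tr_topology G \<sigma> \<alpha>) U))"
  using ring_topology_Tr[OF assms] continuous_action_Tr[OF assms] Tr_finest[OF assms] by blast

end
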